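(* Let $\mathbb{F}$ be a field, and let $\mathcal{E}=(E_j)_{j=0}^n$, $\mathcal{F}=(F_j)_{j=0}^n$, $\mathcal{G}=(G_j)_{j=0}^n$ be complete flags of subspaces in $\mathbb{F}^n$. Let $I=\{i_1<\cdots<i_r\}$, $J=\{j_1<\cdots<j_r\}$, $K=\{k_1<\cdots<k_r\}$ be subsets of $\{1,2,\dots,n\}$ with cardinality $r$ and with the property that $c_{IJK}=1$. Then there exists a subspace $M\subset\mathbb{F}^n$ such that $\dim M=r$ and $$\dim(M\cap E_{i_\ell})\ge\ell,\quad \dim(M\cap F_{j_\ell})\ge\ell,\quad \dim(M\cap G_{k_\ell})\ge\ell$$ for $\ell=1,2,\dots,r$.
   Context: A complete flag in $\mathbb{F}^n$ is a chain of subspaces $E_0\subset E_1\subset\cdots\subset E_n$ with $\dim E_j=j$. Littlewood-Richardson coefficient: for $I,J,K$ of cardinality $r$, $1\le r\le n$, satisfying $\sum_{\ell=1}^r[(i_\ell-\ell)+(j_\ell-\ell)+(k_\ell-\ell)]=2r(n-r)$ (this identity is part of the hypothesis whenever $c_{IJK}$ is mentioned), $c_{IJK}$ is the nonnegative integer counting the $r$-dimensional subspaces $M\subset\mathbb{C}^n$ with $\dim(M\cap E_{i_\ell})\ge\ell$, $\dim(M\cap F_{j_\ell})\ge\ell$, $\dim(M\cap G_{k_\ell})\ge\ell$ for $\ell=1,\dots,r$, for generic complete flags $(E_j),(F_j),(G_j)$ in $\mathbb{C}^n$. Equivalently, it is the integer with $\sigma_I\sigma_J\sigma_K=c_{IJK}[\mathrm{pt}]$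 in the cohomology ring of $\mathrm{Gr}(r,\mathbb{C}^n)$, where $\sigma_I$ is the class of the Schubert variety $\{M:\dim(M\cap E_{i_\ell})\ge\ell,\ \ell=1,\dots,r\}$. (The coefficient does not depend on $\mathbb{F}$.) *)

theory Defs
  imports "HOL-Analysis.Analysis" "HOL-Computational_Algebra.Polynomial"
begin

text \<open>\<open>nth_elem I l\<close> is the \<open>l\<close>-th smallest element of the finite set \<open>I\<close>, counting from \<open>l = 1\<close>.\<close>

definition nth_elem :: "nat set \<Rightarrow> nat \<Rightarrow> nat" where
  "nth_elem I l = sorted_list_of_set I ! (l - 1)"

text \<open>Only the members \<open>E 0, \<dots>, E n\<close> with \<open>n = CARD('n)\<close> of the sequence \<open>E\<close> matter.\<close>

definition complete_flag :: "(nat \<Rightarrow> ('a::field ^ 'n::finite) set) \<Rightarrow> bool" where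
  "complete_flag E \<longleftrightarrow>
     (\<forall>j\<le>CARD('n). vec.subspace (E j) \<and> vec.dim (E j) = j) \<and>
     (\<forall>j<CARD('n). E j \<subset> E (Suc j))"

definition schubert_variety ::
  "(nat \<Rightarrow> ('a::field ^ 'n::finite) set) \<Rightarrow> nat set \<Rightarrow> ('a ^ 'n) set set" where
  "schubert_variety E I =
     {M. vec.subspace M \<and> vec.dim M = card I \<and>
         (\<forall>l\<in>{1..card I}. vec.dim (M \<inter> E (nth_elem I l)) \<ge> l)}"

definition is_basis :: "(nat \<Rightarrow> 'a::field ^ 'n::finite) \<Rightarrow> bool" where
  "is_basis b \<longleftrightarrow> inj_on b {..<CARD('n)} \<and> vec.independent (b ` {..<CARD('n)})"

definition flag_of :: "(nat \<Rightarrow> 'a::field ^ 'n::finite) \<Rightarrow> nat \<Rightarrow> ('a ^ 'n) set" where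
  "flag_of b j = vec.span (b ` {..<j})"

text \<open>Complex polynomial functions of the \<open>3n\<^sup>2\<close> coordinates of three \<open>n\<close>-tuples of vectors in
  \<open>\<complex>\<^sup>n\<close>.\<close>

inductive polynomial3 ::
  "((nat \<Rightarrow> complex ^ 'n::finite) \<Rightarrow> (nat \<Rightarrow> complex ^ 'n) \<Rightarrow> (nat \<Rightarrow> complex ^ 'n) \<Rightarrow> complex) \<Rightarrow> bool"
  where
    const: "polynomial3 (\<lambda>a b c. z)"
  | coord1: "j < CARD('n) \<Longrightarrow> polynomial3 (\<lambda>a b c. a j $ k)"
  | coord2: "j < CARD('n) \<Longrightarrow> polynomial3 (\<lambda>a b c. b j $ k)"
  | coord3: "j < CARD('n) \<Longrightarrow> polynomial3 (\<lambda>a b c. c j $ k)"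
  | add: "polynomial3 p \<Longrightarrow> polynomial3 q \<Longrightarrow> polynomial3 (\<lambda>a b c. p a b c + q a b c)"
  | mult: "polynomial3 p \<Longrightarrow> polynomial3 q \<Longrightarrow> polynomial3 (\<lambda>a b c. p a b c * q a b c)"

text \<open>A property of triples of complete flags in \<open>\<complex>\<^sup>n\<close> holds generically if it holds on a nonempty
  Zariski open subset of \<open>Fl(\<complex>\<^sup>n)\<^sup>3\<close>. The map \<open>flag_of\<close> from the set \<open>GL\<^sub>n\<close> of bases to \<open>Fl(\<complex>\<^sup>n)\<close> is
  surjective, continuous and open, so this is the same as holding for the flags of all triples of
  bases in a nonempty Zariski open subset of \<open>GL\<^sub>n\<^sup>3\<close>, and the principal open subsets form a basis
  of the Zariski topology there.\<close>

definition for_generic_flags ::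
  "((nat \<Rightarrow> (complex ^ 'n::finite) set) \<Rightarrow> (nat \<Rightarrow> (complex ^ 'n) set) \<Rightarrow>
    (nat \<Rightarrow> (complex ^ 'n) set) \<Rightarrow> bool) \<Rightarrow> bool" where
  "for_generic_flags P \<longleftrightarrow>
     (\<exists>p. polynomial3 p \<and>
        (\<exists>a b c. is_basis a \<and> is_basis b \<and> is_basis c \<and> p a b c \<noteq> 0) \<and>
        (\<forall>a b c. is_basis a \<longrightarrow> is_basis b \<longrightarrow> is_basis c \<longrightarrow> p a b c \<noteq> 0 \<longrightarrow>
           P (flag_of a) (flag_of b) (flag_of c)))"

definition generic_count :: "'n::finite itself \<Rightarrow> nat set \<Rightarrow> nat set \<Rightarrow> nat set \<Rightarrow> nat \<Rightarrow> bool" where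
  "generic_count _ I J K m \<longleftrightarrow>
     for_generic_flags (\<lambda>(E :: nat \<Rightarrow> (complex ^ 'n) set) F G.
       finite (schubert_variety E I \<inter> schubert_variety F J \<inter> schubert_variety G K) \<and>
       card (schubert_variety E I \<inter> schubert_variety F J \<inter> schubert_variety G K) = m)"

text \<open>The value 0 in the second case is a mere default: for \<open>I\<close>, \<open>J\<close>, \<open>K\<close> satisfying
  \<open>lr_condition\<close> below, the number of solutions for generic flags exists. It is unique, see
  \<open>lr_coeff_eqI\<close>.\<close>

definition lr_coeff :: "'n::finite itself \<Rightarrow> nat set \<Rightarrow> nat set \<Rightarrow> nat set \<Rightarrow> nat" where
  "lr_coeff T I J K =
     (if \<exists>m. generic_count T I J K m then THE m. generic_count T I J K m else 0)"

text \<open>The condition says that the codimensions of the three Schubert varieties add up to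
  \<open>dim Gr(r, n) = r(n - r)\<close>.\<close>

definition lr_condition :: "nat \<Rightarrow> nat \<Rightarrow> nat set \<Rightarrow> nat set \<Rightarrow> nat set \<Rightarrow> bool" where
  "lr_condition n r I J K \<longleftrightarrow>
     (\<Sum>l = 1..r. (int (nth_elem I l) - int l) + (int (nth_elem J l) - int l)
                 + (int (nth_elem K l) - int l)) = 2 * int r * (int n - int r)"

text \<open>Two generic counts agree: restricting all polynomials (and determinants) to the line through
  two points shows that nonempty Zariski open subsets of \<open>GL\<^sub>n\<^sup>3\<close> meet.\<close>

lemma is_basis_iff_det:
  fixes b :: "nat \<Rightarrow> 'a::field ^ 'n::finite"
  assumes e: "bij_betw e (UNIV :: 'n set) {..<CARD('n)}"
  shows "is_basis b \<longleftrightarrow> det (\<chi> i k. b (e i) $ k) \<noteq> 0"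
proof -
  let ?A = "\<chi> i k. b (e i) $ k"
  have row: "row i ?A = b (e i)" for i
    by (simp add: row_def vec_eq_iff)
  have im: "b ` {..<CARD('n)} = range (b \<circ> e)"
    using e by (metis bij_betw_imp_surj_on image_comp)
  have inj: "inj_on b {..<CARD('n)} \<longleftrightarrow> inj (b \<circ> e)"
    using e by (metis bij_betw_def comp_inj_on_iff)
  have "det ?A \<noteq> 0 \<longleftrightarrow> (\<exists>B. ?A ** B = mat 1)"
    by (simp add: invertible_det_nz[symmetric] invertible_right_inverse)
  also have "\<dots> \<longleftrightarrow> (\<forall>c. (\<Sum>i\<in>UNIV. c i *s b (e i)) = 0 \<longrightarrow> (\<forall>i. c i = 0))"
    unfolding matrix_right_invertible_independent_rows row ..
  also have "\<dots> \<longleftrightarrow> is_basis b"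
  proof
    assume *: "\<forall>c. (\<Sum>i\<in>UNIV. c i *s b (e i)) = 0 \<longrightarrow> (\<forall>i. c i = 0)"
    have i: "inj (b \<circ> e)"
    proof (rule injI, rule ccontr)
      fix x y assume xy: "(b \<circ> e) x = (b \<circ> e) y" "x \<noteq> y"
      let ?c = "\<lambda>i. if i = x then 1 else if i = y then -1 else (0::'a)"
      have "(\<Sum>i\<in>UNIV. ?c i *s b (e i)) = (\<Sum>i\<in>{x,y}. ?c i *s b (e i))"
        by (rule sum.mono_neutral_right) auto
      also have "\<dots> = 0" using xy by simp
      finally have "\<forall>i. ?c i = 0" using *[THEN spec, of ?c] by (rule rev_mp)
      then have "?c x = 0" by (rule spec)
      then show False by simp
    qed
    have "vec.independent (range (b \<circ> e))"
    proof (rule vec.independent_if_scalars_zero)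
      fix f v assume s: "(\<Sum>x\<in>range (b \<circ> e). f x *s x) = 0" and v: "v \<in> range (b \<circ> e)"
      have "(\<Sum>i\<in>UNIV. f (b (e i)) *s b (e i)) = 0"
        using s[unfolded sum.reindex[OF i]] by simp
      then have "\<forall>i. f (b (e i)) = 0"
        using *[THEN spec, of "\<lambda>i. f (b (e i))"] by simp
      then show "f v = 0" using v by auto
    qed simp
    with i inj im show "is_basis b" by (simp add: is_basis_def)
  next
    assume "is_basis b"
    then have i: "inj (b \<circ> e)" and ind: "vec.independent (range (b \<circ> e))"
      using inj im by (auto simp: is_basis_def)
    show "\<forall>c. (\<Sum>i\<in>UNIV. c i *s b (e i)) = 0 \<longrightarrow> (\<forall>i. c i = 0)"
    proof (intro allI impI)
      fix c x assume s: "(\<Sum>i\<in>UNIV. c i *s b (e i)) = 0"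
      have "(\<Sum>v\<in>range (b \<circ> e). c (inv (b \<circ> e) v) *s v) = (\<Sum>i\<in>UNIV. c i *s b (e i))"
        unfolding sum.reindex[OF i] by (simp add: inv_f_f[OF i, unfolded o_def] o_def)
      with s have "(\<Sum>v\<in>range (b \<circ> e). c (inv (b \<circ> e) v) *s v) = 0" by simp
      from vec.independentD[OF ind _ subset_refl this, of "(b \<circ> e) x"]
      show "c x = 0" using inv_f_f[OF i, of x] by simp
    qed
  qed
  finally show ?thesis by simp
qed

definition line :: "(nat \<Rightarrow> complex ^ 'n) \<Rightarrow> (nat \<Rightarrow> complex ^ 'n) \<Rightarrow> complex \<Rightarrow> nat \<Rightarrow> complex ^ 'n"
  where "line a a' t = (\<lambda>j. \<chi> k. a j $ k + t * (a' j $ k - a j $ k))"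

lemma line_0 [simp]: "line a a' 0 = a" and line_1 [simp]: "line a a' 1 = a'"
  by (auto simp: line_def vec_eq_iff)

lemma polynomial3_line:
  assumes "polynomial3 p"
  shows "\<exists>q. \<forall>t. p (line a a' t) (line b b' t) (line c c' t) = poly q t"
  using assms
proof induction
  case (const z) show ?case by (rule exI[of _ "[:z:]"]) simp
next
  case (coord1 j k) show ?case by (rule exI[of _ "[:a j $ k, a' j $ k - a j $ k:]"]) (simp add: line_def)
next
  case (coord2 j k) show ?case by (rule exI[of _ "[:b j $ k, b' j $ k - b j $ k:]"]) (simp add: line_def)
next
  case (coord3 j k) show ?case by (rule exI[of _ "[:c j $ k, c' j $ k - c j $ k:]"]) (simp add: line_def)
next
  case (add p q) then show ?case by (metis poly_add)
next
  case (mult p q) then show ?case by (metis poly_mult)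
qed

lemma is_basis_line:
  fixes a a' :: "nat \<Rightarrow> complex ^ 'n::finite"
  assumes "is_basis a"
  shows "\<exists>q. q \<noteq> 0 \<and> (\<forall>t. poly q t \<noteq> 0 \<longrightarrow> is_basis (line a a' t))"
proof -
  obtain e where e: "bij_betw e (UNIV :: 'n set) {..<CARD('n)}"
    using ex_bij_betw_finite_nat[of "UNIV :: 'n set"] by (auto simp: atLeast0LessThan)
  let ?q = "\<Sum>s\<in>{s. s permutes (UNIV :: 'n set)}. [:of_int (sign s):] *
     (\<Prod>i\<in>UNIV. [:a (e i) $ s i, a' (e i) $ s i - a (e i) $ s i:])"
  have q: "poly ?q t = det (\<chi> i k. line a a' t (e i) $ k)" for t
    by (simp add: det_def poly_sum poly_prod line_def)
  have "poly ?q 0 \<noteq> 0"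
    using assms unfolding q line_0 is_basis_iff_det[OF e] by simp
  then have "?q \<noteq> 0" by auto
  moreover have "\<forall>t. poly ?q t \<noteq> 0 \<longrightarrow> is_basis (line a a' t)"
    unfolding q is_basis_iff_det[OF e] by simp
  ultimately show ?thesis by blast
qed

lemma for_generic_flags_conj:
  assumes "for_generic_flags P" "for_generic_flags Q"
  shows "\<exists>E F G. P E F G \<and> Q E F G"
proof -
  obtain p a b c where p: "polynomial3 p" "is_basis a" "is_basis b" "is_basis c" "p a b c \<noteq> 0"
    "\<And>a b c. is_basis a \<Longrightarrow> is_basis b \<Longrightarrow> is_basis c \<Longrightarrow> p a b c \<noteq> 0 \<Longrightarrow>
       P (flag_of a) (flag_of b) (flag_of c)"
    using assms(1) unfolding for_generic_flags_def by blast
  obtain q a' b' c' where q: "polynomial3 q" "q a' b' c' \<noteq> 0"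
    "\<And>a b c. is_basis a \<Longrightarrow> is_basis b \<Longrightarrow> is_basis c \<Longrightarrow> q a b c \<noteq> 0 \<Longrightarrow>
       Q (flag_of a) (flag_of b) (flag_of c)"
    using assms(2) unfolding for_generic_flags_def by blast
  obtain f where f: "\<And>t. p (line a a' t) (line b b' t) (line c c' t) = poly f t"
    using polynomial3_line[OF p(1)] by blast
  obtain g where g: "\<And>t. q (line a a' t) (line b b' t) (line c c' t) = poly g t"
    using polynomial3_line[OF q(1)] by blast
  have "f \<noteq> 0" using f[of 0] p(5) by auto
  moreover have "g \<noteq> 0" using g[of 1] q(2) by auto
  moreover obtain u where u: "u \<noteq> 0" "\<And>t. poly u t \<noteq> 0 \<Longrightarrow> is_basis (line a a' t)"
    using is_basis_line[OF p(2)] by blast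
  moreover obtain v where v: "v \<noteq> 0" "\<And>t. poly v t \<noteq> 0 \<Longrightarrow> is_basis (line b b' t)"
    using is_basis_line[OF p(3)] by blast
  moreover obtain w where w: "w \<noteq> 0" "\<And>t. poly w t \<noteq> 0 \<Longrightarrow> is_basis (line c c' t)"
    using is_basis_line[OF p(4)] by blast
  ultimately have "f * g * u * v * w \<noteq> 0" by simp
  then obtain t where "poly (f * g * u * v * w) t \<noteq> 0"
    using poly_all_0_iff_0 by blast
  then have "poly f t \<noteq> 0" "poly g t \<noteq> 0" "poly u t \<noteq> 0" "poly v t \<noteq> 0" "poly w t \<noteq> 0"
    by auto
  then show ?thesis
    using p(6) q(3) u(2) v(2) w(2) f g by metis
qed

lemma lr_coeff_eqI:
  assumes "generic_count T I J K m"
  shows "lr_coeff T I J K = m"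
proof -
  have "m' = m" if "generic_count T I J K m'" for m'
    using for_generic_flags_conj[OF that[unfolded generic_count_def] assms[unfolded generic_count_def]]
    by auto
  then show ?thesis
    using assms unfolding lr_coeff_def by (metis (mono_tags, lifting) theI)
qed

end

theory Submission
  imports Defs "HOL-Library.Poly_Mapping" "HOL-Computational_Algebra.Fraction_Field"
    "HOL-Computational_Algebra.Fundamental_Theorem_Algebra"
begin

text \<open>For three flags in \<open>\<complex>\<^sup>n\<close> whose coordinates \<open>x\<^sub>i\<close> are algebraically independent and generic, the
  intersection of the Schubert varieties is a single point \<open>M\<close>. By uniqueness \<open>M\<close> is fixed by all
  homomorphisms over the field generated by the \<open>x\<^sub>i\<close>, so it is defined over \<open>\<rat>(x\<^sub>0, x\<^sub>1, \<dots>)\<close>.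
  The given flags over \<open>'a\<close> are the values of the generic ones under a place of this field with
  \<open>x\<^sub>i \<mapsto> a\<^sub>i \<in> 'a\<close>: reduce the coefficients (the Gauss valuation if the characteristic is positive) to
  get into \<open>'a(x\<^sub>0, x\<^sub>1, \<dots>)\<close>, then take lowest terms at the point \<open>a\<close>. Subspaces specialize along
  places with their dimensions, and dimensions of intersections can only grow.\<close>

section \<open>Ranks and incidences as matrix equations\<close>

text \<open>The count is known only over \<complex>, while the given flags lie over a field of
  arbitrary characteristic and in arbitrary, possibly special position; in general no ring
  homomorphism from \<complex> to \<open>'a\<close> exists that would carry a solution over. The
  intermediary is \<open>int mpoly fract\<close>: algebraic independence embeds it in \<complex>,
  and since it consists of quotients of integer polynomials it has a place into every field, with
  arbitrary values at the variables. Uniqueness serves the descent. Were there several solutions,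
  homomorphisms could permute them, a solution might exist only over an algebraic extension, and
  specializing it might leave \<open>'a\<close>. The second step needs a place because substituting
  values into a matrix can meet poles or lose rank, whereas a subspace always has a limit of the
  same dimension; this is the properness of the Grassmannian. Automorphisms of \<complex> are
  avoided: a contradiction needs only a homomorphism on a countable subring that contains finitely
  many prescribed numbers.\<close>

abbreviation rng :: "'a::field ^ 'm ^ 'n \<Rightarrow> ('a ^ 'n) set" where
  "rng A \<equiv> range ((*v) A)"

lemma subspace_rng: "vec.subspace (rng (A :: 'a::field ^ 'm ^ 'n))"
  by (metis vec.subspace_UNIV vec.subspace_image)

lemma rng_mult_subset: "rng (A ** B) \<subseteq> rng (A :: 'a::field ^ 'm ^ 'n)"
  by (auto simp: matrix_vector_mul_assoc[symmetric])

lemma mult_axis: "A *v axis j 1 = column j (A :: 'a::field ^ 'm ^ 'n)"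
  by (simp add: vec_eq_iff matrix_vector_mult_def axis_def column_def if_distrib cong: if_cong)

lemma column_in_rng: "column j A \<in> rng (A :: 'a::field ^ 'm ^ 'n)"
  by (metis mult_axis rangeI)

lemma rng_subset_iff_columns:
  fixes A :: "'a::field ^ 'm ^ 'n"
  assumes "vec.subspace U"
  shows "rng A \<subseteq> U \<longleftrightarrow> (\<forall>j. column j A \<in> U)"
proof
  assume "\<forall>j. column j A \<in> U"
  then show "rng A \<subseteq> U"
    using assms by (auto simp: matrix_mult_sum intro!: vec.subspace_sum vec.subspace_scale)
qed (use column_in_rng in blast)

lemma rng_subset_rng:
  fixes A :: "'a::field ^ 'm ^ 'n" and B :: "'a ^ 'k ^ 'n"
  assumes "rng A \<subseteq> rng B"
  shows "\<exists>C. A = B ** C"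
proof -
  have "\<forall>j. \<exists>x. B *v x = column j A"
    using assms column_in_rng by (metis (no_types, lifting) imageE subsetD)
  then obtain x where x: "\<And>j. B *v x j = column j A" by metis
  have "A = B ** (\<chi> i j. x j $ i)"
    using x by (simp add: vec_eq_iff matrix_matrix_mult_def matrix_vector_mult_def column_def)
  then show ?thesis ..
qed

text \<open>The type \<open>'n\<close> carries no order, so the first columns of a matrix make sense
  only after a choice of enumeration.\<close>

definition idx :: "'n::finite \<Rightarrow> nat" where
  "idx = (SOME e. bij_betw e UNIV {..<CARD('n)})"

lemma bij_idx: "bij_betw (idx :: 'n::finite \<Rightarrow> nat) UNIV {..<CARD('n)}"
proof -
  have "\<exists>e. bij_betw e (UNIV :: 'n set) {..<CARD('n)}"
    using ex_bij_betw_finite_nat[of "UNIV :: 'n set"] by (auto simp: atLeast0LessThan)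
  then show ?thesis unfolding idx_def by (rule someI_ex)
qed

text \<open>Square matrices of one fixed type have to represent subspaces of every dimension.
  Multiplying by this idempotent on the right keeps the first \<open>l\<close> columns and clears
  the others.\<close>

definition diag_upto :: "nat \<Rightarrow> 'a::zero_neq_one ^ 'n ^ 'n::finite" where
  "diag_upto l = (\<chi> i j. if i = j \<and> idx i < l then 1 else 0)"

lemma column_mult: "column j (A ** B) = A *v column j B" for A :: "'a::semiring_1 ^ 'm ^ 'n"
  by (simp add: vec_eq_iff column_def matrix_matrix_mult_def matrix_vector_mult_def)

lemma column_diag_upto: "column j (diag_upto l) = (if idx j < l then axis j 1 else (0 :: 'a::field ^ 'n))"
  by (auto simp: vec_eq_iff column_def diag_upto_def axis_def)

lemma column_mult_diag_upto:
  "column j (A ** diag_upto l) = (if idx j < l then column j A else (0 :: 'a::field ^ 'm))"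
  by (simp add: column_mult column_diag_upto mult_axis)

lemma mult_diag_upto_eq:
  assumes "\<And>j. \<not> idx j < l \<Longrightarrow> column j A = 0"
  shows "A ** diag_upto l = (A :: 'a::field ^ 'n ^ 'm)"
proof -
  have "column j (A ** diag_upto l) = column j A" for j
    using assms by (simp add: column_mult_diag_upto)
  then show ?thesis by (simp add: vec_eq_iff column_def)
qed

lemma bij_betw_idx_less:
  assumes "l \<le> CARD('n::finite)"
  shows "bij_betw (idx :: 'n \<Rightarrow> nat) {j. idx j < l} {..<l}"
proof -
  have "(idx :: 'n \<Rightarrow> nat) ` {j. idx j < l} = {..<l}"
  proof -
    have "k \<in> idx ` {j::'n. idx j < l}" if "k < l" for k
    proof -
      have "k \<in> range (idx :: 'n \<Rightarrow> nat)"
        using bij_idx[where ?'n = 'n] assms that by (auto simp: bij_betw_def)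
      then show ?thesis using that by auto
    qed
    then show ?thesis by auto
  qed
  moreover have "inj_on (idx :: 'n \<Rightarrow> nat) {j. idx j < l}"
    using bij_idx[where ?'n = 'n] inj_on_subset by (auto simp: bij_betw_def)
  ultimately show ?thesis by (simp add: bij_betw_def)
qed

lemma dim_rng_diag_upto:
  assumes "l \<le> CARD('n::finite)"
  shows "vec.dim (rng (diag_upto l :: 'a::field ^ 'n ^ 'n)) = l"
proof -
  let ?B = "(\<lambda>j. axis j 1 :: 'a ^ 'n) ` {j. idx j < l}"
  have inj: "inj_on (\<lambda>j. axis j 1 :: 'a ^ 'n) {j. idx j < l}"
    by (auto simp: inj_on_def axis_eq_axis)
  have ind: "vec.independent ?B"
    by (rule vec.independent_mono[OF independent_cart_basis]) (auto simp: cart_basis_def)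
  have "rng (diag_upto l :: 'a ^ 'n ^ 'n) \<subseteq> vec.span ?B"
    by (subst rng_subset_iff_columns) (auto simp: column_diag_upto vec.span_zero intro: vec.span_base)
  moreover have "?B \<subseteq> rng (diag_upto l :: 'a ^ 'n ^ 'n)"
  proof safe
    fix j :: 'n assume "idx j < l"
    then show "axis j 1 \<in> rng (diag_upto l :: 'a ^ 'n ^ 'n)"
      using column_in_rng[of j "diag_upto l :: 'a ^ 'n ^ 'n"] by (simp add: column_diag_upto)
  qed
  ultimately have "card ?B = vec.dim (rng (diag_upto l :: 'a ^ 'n ^ 'n))"
    using ind by (intro vec.basis_card_eq_dim)
  then show ?thesis
    using bij_betw_same_card[OF bij_betw_idx_less[OF assms]] by (simp add: card_image[OF inj])
qed

text \<open>Linear independence is not a finite list of equations, but the existence of a left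
  inverse is. The first \<open>l\<close> columns of \<open>X\<close> are independent vectors of
  \<open>U\<close>, and \<open>Y\<close> extends the linear map that sends them to coordinate
  vectors.\<close>

lemma dim_ge_witness:
  fixes U :: "('a::field ^ 'n::finite) set"
  assumes "vec.subspace U" and "l \<le> vec.dim U"
  shows "\<exists>(X :: 'a ^ 'n ^ 'n) (Y :: 'a ^ 'n ^ 'n). Y ** X = diag_upto l \<and> rng X \<subseteq> U"
proof -
  obtain B where B: "B \<subseteq> U" "vec.independent B" "U \<subseteq> vec.span B" "card B = vec.dim U"
    using vec.basis_exists by blast
  obtain B' where B': "B' \<subseteq> B" "card B' = l"
    using assms(2) B(4) by (metis obtain_subset_with_card_n)
  have ind: "vec.independent B'" using B B' vec.independent_mono by blast
  then have fin: "finite B'" using vec.finiteI_independent by blast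
  have "l \<le> CARD('n)"
    using assms(2) by (metis dim_subset_UNIV_cart_gen le_trans)
  then have "card {j::'n. idx j < l} = card B'"
    using bij_betw_same_card[OF bij_betw_idx_less] B' by (metis card_lessThan)
  then obtain f where f: "bij_betw f {j::'n. idx j < l} B'"
    using fin by (meson finite finite_same_card_bij)
  let ?X = "(\<chi> k j. if idx j < l then f j $ k else 0) :: 'a ^ 'n ^ 'n"
  have colX: "column j ?X = (if idx j < l then f j else 0)" for j
    by (simp add: vec_eq_iff column_def)
  obtain g where g: "Vector_Spaces.linear (*s) (*s) g"
    "\<forall>x\<in>B'. g x = (axis (inv_into {j. idx j < l} f x) 1 :: 'a ^ 'n)"
    using vec.linear_independent_extend[OF ind, of "\<lambda>x. axis (inv_into {j. idx j < l} f x) 1"]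
    by blast
  have "column j (matrix g ** ?X) = column j (diag_upto l)" for j
  proof (cases "idx j < l")
    case True
    then have "f j \<in> B'" "inv_into {j. idx j < l} f (f j) = j"
      using f by (auto simp: bij_betw_def)
    then show ?thesis
      using g True by (simp add: column_mult colX matrix_works column_diag_upto)
  next
    case False
    then show ?thesis by (simp add: column_mult colX column_diag_upto)
  qed
  then have "matrix g ** ?X = diag_upto l"
    by (simp add: vec_eq_iff column_def)
  moreover have "f j \<in> U" if "idx j < l" for j
    using that bij_betwE[OF f] B B' by blast
  then have "rng ?X \<subseteq> U"
    using assms(1) by (subst rng_subset_iff_columns) (auto simp: colX vec.subspace_0)
  ultimately show ?thesis by blast
qed

text \<open>\<open>Y\<close> maps \<open>rng X\<close> onto a space of dimension \<open>l\<close>,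
  and linear maps do not raise dimensions.\<close>

lemma dim_ge_of_witness:
  fixes X Y :: "'a::field ^ 'n ^ 'n::finite"
  assumes "Y ** X = diag_upto l" and "rng X \<subseteq> U" and "l \<le> CARD('n)"
  shows "l \<le> vec.dim U"
proof -
  have "rng (diag_upto l :: 'a ^ 'n ^ 'n) = (*v) Y ` rng X"
    by (simp add: assms(1)[symmetric] image_image matrix_vector_mul_assoc)
  then have "l = vec.dim ((*v) Y ` rng X)"
    using dim_rng_diag_upto[OF assms(3), where ?'a='a] by simp
  also have "\<dots> \<le> vec.dim (rng X)"
    by (rule vec.dim_image_le[OF matrix_vector_mul_linear_gen])
  also have "\<dots> \<le> vec.dim U" by (rule vec.dim_subset[OF assms(2)])
  finally show ?thesis .
qed

text \<open>The factor \<open>diag_upto\<close> is kept explicit because a factorization through it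
  bounds the rank from above, also after a homomorphism has been applied to
  \<open>X\<close>.\<close>

lemma subspace_eq_rng:
  fixes U :: "('a::field ^ 'n::finite) set"
  assumes "vec.subspace U"
  shows "\<exists>X :: 'a ^ 'n ^ 'n. U = rng (X ** diag_upto (vec.dim U)) \<and> (\<exists>Y. Y ** X = diag_upto (vec.dim U))"
proof -
  obtain X Y :: "'a ^ 'n ^ 'n" where X: "Y ** X = diag_upto (vec.dim U)" "rng X \<subseteq> U"
    using dim_ge_witness[OF assms order_refl] by blast
  let ?D = "diag_upto (vec.dim U) :: 'a ^ 'n ^ 'n"
  have le: "vec.dim U \<le> CARD('n)" by (metis dim_subset_UNIV_cart_gen)
  have "?D ** ?D = ?D" by (rule mult_diag_upto_eq) (simp add: column_diag_upto)
  then have "Y ** (X ** ?D) = ?D" using X(1) by (metis matrix_mul_assoc)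
  then have "vec.dim U \<le> vec.dim (rng (X ** ?D))"
    by (rule dim_ge_of_witness) (use le in auto)
  moreover have "rng (X ** ?D) \<subseteq> U" using rng_mult_subset X(2) by blast
  ultimately have "rng (X ** ?D) = U"
    using assms subspace_rng by (intro vec.subspace_dim_equal)
  then show ?thesis using X(1) by blast
qed

lemma dim_rng_mult_diag_upto_le:
  fixes X Z :: "'a::field ^ 'n ^ 'n::finite"
  shows "vec.dim (rng (X ** diag_upto l ** Z)) \<le> l"
proof (cases "l \<le> CARD('n)")
  case True
  have "rng (X ** diag_upto l ** Z) \<subseteq> (*v) X ` rng (diag_upto l)"
    by (auto simp: matrix_vector_mul_assoc[symmetric])
  then have "vec.dim (rng (X ** diag_upto l ** Z)) \<le> vec.dim ((*v) X ` rng (diag_upto l))"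
    by (rule vec.dim_subset)
  also have "\<dots> \<le> vec.dim (rng (diag_upto l :: 'a ^ 'n ^ 'n))"
    by (rule vec.dim_image_le[OF matrix_vector_mul_linear_gen])
  also have "\<dots> = l" by (rule dim_rng_diag_upto[OF True])
  finally show ?thesis .
next
  case False
  then show ?thesis by (metis dim_subset_UNIV_cart_gen le_trans nle_le)
qed

text \<open>Homomorphisms are partial: \<open>T\<close> is a subring, not always a subfield, and
  \<open>\<sigma>\<close> is arbitrary outside it. Residue maps of valuation rings, field embeddings
  (with \<open>T = UNIV\<close>) and maps on countable subrings of \<complex> are all
  instances.\<close>

locale ring_hom_on =
  fixes T :: "'a::field set" and \<sigma> :: "'a \<Rightarrow> 'b::field"
  assumes one_mem: "1 \<in> T"
    and add_mem: "\<And>x y. x \<in> T \<Longrightarrow> y \<in> T \<Longrightarrow> x + y \<in> T"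
    and uminus_mem: "\<And>x. x \<in> T \<Longrightarrow> - x \<in> T"
    and mult_mem: "\<And>x y. x \<in> T \<Longrightarrow> y \<in> T \<Longrightarrow> x * y \<in> T"
    and hom_one: "\<sigma> 1 = 1"
    and hom_add: "\<And>x y. x \<in> T \<Longrightarrow> y \<in> T \<Longrightarrow> \<sigma> (x + y) = \<sigma> x + \<sigma> y"
    and hom_mult: "\<And>x y. x \<in> T \<Longrightarrow> y \<in> T \<Longrightarrow> \<sigma> (x * y) = \<sigma> x * \<sigma> y"
begin

lemma zero_mem: "0 \<in> T"
  using add_mem[OF one_mem uminus_mem[OF one_mem]] by simp

lemma hom_zero: "\<sigma> 0 = 0"
  using hom_add[OF zero_mem zero_mem] by (metis add_cancel_right_right add_0)

lemma hom_uminus: "x \<in> T \<Longrightarrow> \<sigma> (- x) = - \<sigma> x"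
  using hom_add[of x "- x"] uminus_mem hom_zero by (simp add: eq_neg_iff_add_eq_0 add.commute)

lemma diff_mem: "x \<in> T \<Longrightarrow> y \<in> T \<Longrightarrow> x - y \<in> T"
  using add_mem[of x "- y"] uminus_mem by simp

lemma hom_diff: "x \<in> T \<Longrightarrow> y \<in> T \<Longrightarrow> \<sigma> (x - y) = \<sigma> x - \<sigma> y"
  using hom_add[of x "- y"] uminus_mem hom_uminus by simp

lemma sum_mem: "(\<And>i. i \<in> A \<Longrightarrow> f i \<in> T) \<Longrightarrow> sum f A \<in> T"
  by (induction A rule: infinite_finite_induct) (auto simp: zero_mem add_mem)

lemma hom_sum: "(\<And>i. i \<in> A \<Longrightarrow> f i \<in> T) \<Longrightarrow> \<sigma> (sum f A) = (\<Sum>i\<in>A. \<sigma> (f i))"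
  by (induction A rule: infinite_finite_induct) (auto simp: hom_zero hom_add sum_mem)

lemma map_matrix_mult:
  fixes X :: "'a ^ 'm ^ 'n" and Y :: "'a ^ 'k ^ 'm"
  assumes "\<And>i j. X $ i $ j \<in> T" and "\<And>i j. Y $ i $ j \<in> T"
  shows "map_matrix \<sigma> (X ** Y) = map_matrix \<sigma> X ** map_matrix \<sigma> Y"
  using assms by (simp add: vec_eq_iff matrix_matrix_mult_def hom_sum hom_mult mult_mem)

lemma matrix_mult_mem:
  assumes "\<And>i j. X $ i $ j \<in> T" and "\<And>i j. Y $ i $ j \<in> T"
  shows "(X ** Y) $ i $ j \<in> T"
  using assms by (simp add: matrix_matrix_mult_def sum_mem mult_mem)

lemma map_matrix_diag_upto: "map_matrix \<sigma> (diag_upto l) = diag_upto l"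
  by (simp add: vec_eq_iff diag_upto_def hom_zero hom_one)

lemma diag_upto_mem: "diag_upto l $ i $ j \<in> T"
  by (simp add: diag_upto_def one_mem zero_mem)

end

section \<open>Finite certificates for ranks and incidences\<close>

definition entries :: "'a ^ 'm ^ 'n \<Rightarrow> 'a set" where
  "entries A = (\<lambda>(i, j). A $ i $ j) ` UNIV"

lemma finite_entries [simp]: "finite (entries (A :: 'a ^ 'm::finite ^ 'n::finite))"
  by (simp add: entries_def)

lemma entries_subset_iff: "entries A \<subseteq> T \<longleftrightarrow> (\<forall>i j. A $ i $ j \<in> T)"
  by (auto simp: entries_def)

text \<open>Ranks and incidences are certified by matrix equations, and these are preserved by every ring
  homomorphism whose domain contains the finitely many entries involved.\<close>

lemma dim_rng_Int_certificate:
  fixes P Q :: "'a::field ^ 'n ^ 'n::finite"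
  assumes "l \<le> vec.dim (rng Q \<inter> rng P)"
  shows "\<exists>B. finite B \<and> (\<forall>T (\<sigma> :: 'a \<Rightarrow> 'b::field). ring_hom_on T \<sigma> \<longrightarrow> B \<subseteq> T \<longrightarrow>
           l \<le> vec.dim (rng (map_matrix \<sigma> Q) \<inter> rng (map_matrix \<sigma> P)))"
proof -
  have le: "l \<le> CARD('n)"
    using assms by (metis dim_subset_UNIV_cart_gen le_trans)
  obtain X Y :: "'a ^ 'n ^ 'n" where X: "Y ** X = diag_upto l" "rng X \<subseteq> rng Q \<inter> rng P"
    using dim_ge_witness[OF vec.subspace_inter[OF subspace_rng subspace_rng] assms] by blast
  obtain V where V: "X = Q ** V" using rng_subset_rng X(2) by blast
  obtain W where W: "X = P ** W" using rng_subset_rng X(2) by blast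
  let ?B = "entries X \<union> entries Y \<union> entries V \<union> entries W \<union> entries P \<union> entries Q"
  have main: "l \<le> vec.dim (rng (map_matrix \<sigma> Q) \<inter> rng (map_matrix \<sigma> P))"
    if h: "ring_hom_on T \<sigma>" and B: "?B \<subseteq> T" for T and \<sigma> :: "'a \<Rightarrow> 'b"
  proof -
    interpret ring_hom_on T \<sigma> by fact
    have e: "X $ i $ j \<in> T" "Y $ i $ j \<in> T" "V $ i $ j \<in> T" "W $ i $ j \<in> T" "P $ i $ j \<in> T"
      "Q $ i $ j \<in> T" for i j
      using B by (auto simp: entries_subset_iff)
    have "map_matrix \<sigma> X = map_matrix \<sigma> Q ** map_matrix \<sigma> V"
      by (subst V) (intro map_matrix_mult e)
    then have "rng (map_matrix \<sigma> X) \<subseteq> rng (map_matrix \<sigma> Q)"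
      using rng_mult_subset[of "map_matrix \<sigma> Q" "map_matrix \<sigma> V"] by (simp only:)
    moreover have "map_matrix \<sigma> X = map_matrix \<sigma> P ** map_matrix \<sigma> W"
      by (subst W) (intro map_matrix_mult e)
    then have "rng (map_matrix \<sigma> X) \<subseteq> rng (map_matrix \<sigma> P)"
      using rng_mult_subset[of "map_matrix \<sigma> P" "map_matrix \<sigma> W"] by (simp only:)
    ultimately have "rng (map_matrix \<sigma> X) \<subseteq> rng (map_matrix \<sigma> Q) \<inter> rng (map_matrix \<sigma> P)"
      by blast
    moreover have "map_matrix \<sigma> Y ** map_matrix \<sigma> X = diag_upto l"
      using map_matrix_mult[OF e(2) e(1)] unfolding X(1) map_matrix_diag_upto by (rule sym)
    ultimately show ?thesis using le by (intro dim_ge_of_witness)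
  qed
  show ?thesis
    by (intro exI[of _ ?B] conjI allI impI, simp, rule main; assumption)
qed

text \<open>An upper bound is certified by a factorization of \<open>Q\<close> through
  \<open>diag_upto\<close> of its rank; applying \<open>\<sigma>\<close> to the two outer factors
  keeps the bound.\<close>

lemma dim_rng_le_certificate:
  fixes Q :: "'a::field ^ 'n ^ 'n::finite"
  shows "\<exists>B. finite B \<and> (\<forall>T (\<sigma> :: 'a \<Rightarrow> 'b::field). ring_hom_on T \<sigma> \<longrightarrow> B \<subseteq> T \<longrightarrow>
           vec.dim (rng (map_matrix \<sigma> Q)) \<le> vec.dim (rng Q))"
proof -
  let ?l = "vec.dim (rng Q)"
  obtain X :: "'a ^ 'n ^ 'n" where X: "rng Q = rng (X ** diag_upto ?l)"
    using subspace_eq_rng[OF subspace_rng] by blast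
  obtain Z where Z: "Q = X ** diag_upto ?l ** Z"
    using rng_subset_rng X by blast
  let ?B = "entries X \<union> entries Z"
  have main: "vec.dim (rng (map_matrix \<sigma> Q)) \<le> ?l"
    if h: "ring_hom_on T \<sigma>" and B: "?B \<subseteq> T" for T and \<sigma> :: "'a \<Rightarrow> 'b"
  proof -
    interpret ring_hom_on T \<sigma> by fact
    have e: "X $ i $ j \<in> T" "Z $ i $ j \<in> T" for i j
      using B by (auto simp: entries_subset_iff)
    have "map_matrix \<sigma> (X ** diag_upto ?l ** Z) = map_matrix \<sigma> X ** diag_upto ?l ** map_matrix \<sigma> Z"
      by (simp add: map_matrix_mult matrix_mult_mem e diag_upto_mem map_matrix_diag_upto)
    then have "map_matrix \<sigma> Q = map_matrix \<sigma> X ** diag_upto ?l ** map_matrix \<sigma> Z"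
      using Z by simp
    then show ?thesis by (simp add: dim_rng_mult_diag_upto_le)
  qed
  show ?thesis
    by (intro exI[of _ ?B] conjI allI impI, simp, rule main; assumption)
qed

text \<open>For \<open>T = UNIV\<close> the condition on the certificates is void, and the lower and
  upper bounds meet.\<close>

lemma dim_rng_map_matrix:
  fixes Q :: "'a::field ^ 'n ^ 'n::finite" and \<iota> :: "'a \<Rightarrow> 'b::field"
  assumes "ring_hom_on UNIV \<iota>"
  shows "vec.dim (rng (map_matrix \<iota> Q)) = vec.dim (rng Q)"
proof (rule antisym)
  show "vec.dim (rng (map_matrix \<iota> Q)) \<le> vec.dim (rng Q)"
    using dim_rng_le_certificate[of Q, where ?'b = 'b] assms by blast
  show "vec.dim (rng Q) \<le> vec.dim (rng (map_matrix \<iota> Q))"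
    using dim_rng_Int_certificate[of "vec.dim (rng Q)" Q Q, where ?'b = 'b] assms by auto
qed

text \<open>Intersections of Schubert varieties in a Grassmannian, where the members of the flags are given
  as column spaces of square matrices \<open>P\<close>.\<close>

definition solutions :: "(('a::field ^ 'n ^ 'n) \<times> nat) set \<Rightarrow> nat \<Rightarrow> ('a ^ 'n::finite) set set" where
  "solutions C r = {M. vec.subspace M \<and> vec.dim M = r \<and> (\<forall>(P, l)\<in>C. l \<le> vec.dim (M \<inter> rng P))}"

text \<open>The dimension of an intersection is computed from ranks via \<open>dim (U \<inter> V) + dim (U + V) =
  dim U + dim V\<close>, and ranks do not change under field extensions.\<close>

lemma solutions_descend:
  fixes Q :: "'a::field ^ 'n ^ 'n::finite" and \<iota> :: "'a \<Rightarrow> 'b::field"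
  assumes hom: "ring_hom_on UNIV \<iota>"
    and sol: "rng (map_matrix \<iota> Q) \<in> solutions ((\<lambda>(P, l). (map_matrix \<iota> P, l)) ` C) r"
  shows "rng Q \<in> solutions C r"
proof -
  interpret ring_hom_on UNIV \<iota> by fact
  have mult: "map_matrix \<iota> (X ** Y) = map_matrix \<iota> X ** map_matrix \<iota> Y" for X Y :: "'a ^ 'n ^ 'n"
    by (rule map_matrix_mult) auto
  have add: "map_matrix \<iota> (X + Y) = map_matrix \<iota> X + map_matrix \<iota> Y" for X Y :: "'a ^ 'n ^ 'n"
    by (simp add: vec_eq_iff hom_add)
  have "l \<le> vec.dim (rng Q \<inter> rng P)" if "(P, l) \<in> C" for P l
  proof -
    let ?Q = "map_matrix \<iota> Q" and ?P = "map_matrix \<iota> P"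
    let ?S = "{x + y |x y. x \<in> rng Q \<and> y \<in> rng P}"
    let ?S' = "{x + y |x y. x \<in> rng ?Q \<and> y \<in> rng ?P}"
    obtain R :: "'a ^ 'n ^ 'n" where R: "?S = rng R"
      using subspace_eq_rng[OF vec.subspace_sums[OF subspace_rng subspace_rng], of Q P] by blast
    have "\<forall>j. \<exists>x y. column j R = Q *v x + P *v y"
    proof
      fix j
      have "column j R \<in> ?S" unfolding R by (rule column_in_rng)
      then show "\<exists>x y. column j R = Q *v x + P *v y" by blast
    qed
    then obtain x y where xy: "\<And>j. column j R = Q *v x j + P *v y j" by metis
    have "R = Q ** (\<chi> i j. x j $ i) + P ** (\<chi> i j. y j $ i)"
      using xy by (simp add: vec_eq_iff matrix_matrix_mult_def matrix_vector_mult_def column_def)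
    then obtain X Y where "R = Q ** X + P ** Y" by blast
    then have "map_matrix \<iota> R = ?Q ** map_matrix \<iota> X + ?P ** map_matrix \<iota> Y"
      by (simp add: mult add)
    \<comment> \<open>This inclusion suffices: it gives \<open>dim ?S \<le> dim ?S'\<close>, and the
      ranks of \<open>Q\<close> and \<open>P\<close> are unchanged, so the intersection over
      \<open>'a\<close> is at least as large as the one over \<open>'b\<close>.\<close>
    then have sub: "rng (map_matrix \<iota> R) \<subseteq> ?S'"
      by (auto simp: matrix_vector_mult_add_rdistrib matrix_vector_mul_assoc[symmetric])
    have "l \<le> vec.dim (rng ?Q \<inter> rng ?P)" using sol that by (auto simp: solutions_def)
    moreover have "vec.dim ?S' + vec.dim (rng ?Q \<inter> rng ?P) = vec.dim (rng ?Q) + vec.dim (rng ?P)"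
      by (rule vec.dim_sums_Int[OF subspace_rng subspace_rng])
    moreover have "vec.dim ?S + vec.dim (rng Q \<inter> rng P) = vec.dim (rng Q) + vec.dim (rng P)"
      by (rule vec.dim_sums_Int[OF subspace_rng subspace_rng])
    moreover have "vec.dim ?S \<le> vec.dim ?S'"
      unfolding R using vec.dim_subset[OF sub] dim_rng_map_matrix[OF hom, of R] by linarith
    ultimately show ?thesis
      using dim_rng_map_matrix[OF hom, of Q] dim_rng_map_matrix[OF hom, of P] by linarith
  qed
  then show ?thesis
    using sol dim_rng_map_matrix[OF hom, of Q] by (auto simp: solutions_def subspace_rng)
qed

section \<open>Specialization of subspaces along places\<close>

text \<open>\<open>O\<^sub>v\<close> is a valuation ring, and the kernel of \<open>\<pi>\<close> is
  its maximal ideal. There is no value group; valuations are compared by asking whether a quotient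
  lies in \<open>O\<^sub>v\<close>. The map \<open>\<pi>\<close> need not be surjective.\<close>

locale place = ring_hom_on O\<^sub>v \<pi> for O\<^sub>v :: "'a::field set" and \<pi> :: "'a \<Rightarrow> 'b::field" +
  assumes inverse_mem: "x \<notin> O\<^sub>v \<Longrightarrow> inverse x \<in> O\<^sub>v"
    and hom_inverse: "x \<notin> O\<^sub>v \<Longrightarrow> \<pi> (inverse x) = 0"
begin

lemma inverse_mem_if_unit: "x \<in> O\<^sub>v \<Longrightarrow> \<pi> x \<noteq> 0 \<Longrightarrow> inverse x \<in> O\<^sub>v"
  using hom_inverse[of "inverse x"] by auto

text \<open>Such a \<open>y\<close> has least valuation in \<open>A\<close>. The comparison is
  transitive because \<open>O\<^sub>v\<close> is closed under products of quotients.\<close>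

lemma ex_dominant:
  assumes "finite A" and "A \<noteq> {}" and "0 \<notin> A"
  shows "\<exists>y\<in>A. \<forall>x\<in>A. x / y \<in> O\<^sub>v"
  using assms
proof (induction A rule: finite_ne_induct)
  case (singleton x)
  then show ?case by (simp add: one_mem)
next
  case (insert z A)
  then obtain y where y: "y \<in> A" "\<forall>x\<in>A. x / y \<in> O\<^sub>v" by auto
  show ?case
  proof (cases "z / y \<in> O\<^sub>v")
    case True
    then show ?thesis using y by auto
  next
    case False
    then have *: "y / z \<in> O\<^sub>v" using inverse_mem[of "z / y"] by simp
    have "x / z \<in> O\<^sub>v" if "x \<in> A" for x
    proof -
      have "y \<noteq> 0" using y(1) insert.prems by blast
      then have "x / y * (y / z) = x / z" by simp
      then show ?thesis using mult_mem[OF y(2)[rule_format, OF that] *] by metis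
    qed
    then show ?thesis using insert.prems by (auto simp: one_mem)
  qed
qed

definition reduce_vec :: "'a ^ 'n \<Rightarrow> 'b ^ 'n" where
  "reduce_vec v = (\<chi> i. \<pi> (v $ i))"

text \<open>The reduced vectors form a vector space only over the image of \<open>\<pi>\<close>,
  which may be a proper subfield of \<open>'b\<close>; hence the span.\<close>

definition reduction :: "('a ^ 'n) set \<Rightarrow> ('b ^ 'n) set" where
  "reduction U = vec.span (reduce_vec ` {v \<in> U. \<forall>i. v $ i \<in> O\<^sub>v})"

lemma subspace_reduction: "vec.subspace (reduction U)"
  by (simp add: reduction_def)

lemma reduction_mono: "U \<subseteq> V \<Longrightarrow> reduction U \<subseteq> reduction V"
  unfolding reduction_def by (rule vec.span_mono) auto

text \<open>Divide \<open>u\<close> by a coordinate of least valuation.\<close>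

lemma ex_primitive_vec:
  fixes U :: "('a ^ 'n::finite) set"
  assumes "vec.subspace U" and "u \<in> U" and "u \<noteq> 0"
  shows "\<exists>v\<in>U. \<exists>k. v $ k = 1 \<and> (\<forall>i. v $ i \<in> O\<^sub>v)"
proof -
  let ?A = "{u $ i |i. u $ i \<noteq> 0}"
  have "?A \<noteq> {}" using assms(3) by (auto simp: vec_eq_iff)
  moreover have "finite ?A" by (rule finite_subset[of _ "range (\<lambda>i. u $ i)"]) auto
  ultimately obtain y where "y \<in> ?A" and y: "\<forall>x\<in>?A. x / y \<in> O\<^sub>v"
    using ex_dominant[of ?A] by auto
  then obtain k where k: "y = u $ k" "u $ k \<noteq> 0" by auto
  let ?v = "inverse y *s u"
  have "?v \<in> U" using assms vec.subspace_scale by blast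
  moreover have "?v $ k = 1" using k by simp
  moreover have "?v $ i \<in> O\<^sub>v" for i
  proof (cases "u $ i = 0")
    case False
    then have "u $ i / y \<in> O\<^sub>v" using y by blast
    then show ?thesis by (simp add: divide_inverse mult.commute)
  qed (simp add: zero_mem)
  ultimately show ?thesis by blast
qed

text \<open>Gaussian elimination: a vector \<open>v\<close> with integral coordinates and \<open>v $ k = 1\<close> splits off from \<open>U\<close>,
  and its reduction splits off from the reduction of \<open>U\<close>.\<close>

lemma dim_reduction:
  fixes U :: "('a ^ 'n::finite) set"
  assumes "vec.subspace U"
  shows "vec.dim (reduction U) = vec.dim U"
  using assms
proof (induction "vec.dim U" arbitrary: U)
  case 0
  then have "U \<subseteq> {0}" by simp
  then have "reduce_vec ` {v \<in> U. \<forall>i. v $ i \<in> O\<^sub>v} \<subseteq> {0}"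
    by (auto simp: reduce_vec_def vec_eq_iff hom_zero)
  then have "vec.dim (reduce_vec ` {v \<in> U. \<forall>i. v $ i \<in> O\<^sub>v}) = 0"
    using vec.dim_eq_0 by blast
  then show ?case unfolding reduction_def vec.dim_span using 0(1) by linarith
next
  case (Suc d)
  have "\<not> U \<subseteq> {0}" using Suc.hyps(2) by (metis vec.dim_eq_0 nat.distinct(1))
  then obtain u where "u \<in> U" "u \<noteq> 0" by blast
  then obtain v k where v: "v \<in> U" "v $ k = 1" "\<And>i. v $ i \<in> O\<^sub>v"
    using ex_primitive_vec[OF Suc.prems] by blast
  let ?U = "{u \<in> U. u $ k = 0}"
  have sub: "vec.subspace ?U"
    using Suc.prems by (auto simp: vec.subspace_def)
  have span: "vec.span ?U = ?U" using sub by (simp add: vec.span_eq_iff)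
  have split: "u - u $ k *s v \<in> ?U" if "u \<in> U" for u
    using that v(1,2) Suc.prems by (auto intro: vec.subspace_diff vec.subspace_scale)
  have "U \<subseteq> vec.span (insert v ?U)"
  proof
    fix u assume "u \<in> U"
    then have "u - u $ k *s v \<in> vec.span (insert v ?U)"
      using split by (meson vec.span_base insertI2)
    moreover have "u $ k *s v \<in> vec.span (insert v ?U)"
      by (simp add: vec.span_base vec.span_scale)
    ultimately show "u \<in> vec.span (insert v ?U)"
      using vec.span_add by fastforce
  qed
  moreover have "vec.span (insert v ?U) \<subseteq> U"
    using v(1) Suc.prems by (intro vec.span_minimal) auto
  ultimately have "vec.dim U = vec.dim (insert v ?U)" by (metis vec.dim_span subset_antisym)
  then have dim: "vec.dim U = Suc (vec.dim ?U)"
    using v(2) span by (simp add: vec.dim_insert)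
  let ?w = "reduce_vec v"
  have wk: "?w $ k = 1" using v(2) by (simp add: reduce_vec_def hom_one)
  have "reduction ?U \<subseteq> {x. x $ k = 0}"
    unfolding reduction_def
    by (rule vec.span_minimal) (auto simp: reduce_vec_def hom_zero vec.subspace_def)
  then have notin: "?w \<notin> reduction ?U" using wk by auto
  have "?w \<in> reduction U"
    unfolding reduction_def using v by (intro vec.span_base) auto
  then have "vec.span (insert ?w (reduction ?U)) \<subseteq> reduction U"
    using reduction_mono[of ?U U] by (intro vec.span_minimal subspace_reduction) auto
  moreover have "reduction U \<subseteq> vec.span (insert ?w (reduction ?U))"
    unfolding reduction_def[of U]
  proof (rule vec.span_minimal, safe)
    fix u assume u: "u \<in> U" "\<forall>i. u $ i \<in> O\<^sub>v"
    let ?u = "u - u $ k *s v"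
    have "\<forall>i. ?u $ i \<in> O\<^sub>v" using u v by (auto intro: diff_mem mult_mem)
    then have "reduce_vec ?u \<in> reduction ?U"
      unfolding reduction_def using split[OF u(1)] by (intro vec.span_base imageI) auto
    then have "reduce_vec ?u \<in> vec.span (insert ?w (reduction ?U))"
      by (meson vec.span_base insertI2)
    moreover have "\<pi> (u $ k) *s ?w \<in> vec.span (insert ?w (reduction ?U))"
      by (simp add: vec.span_base vec.span_scale)
    ultimately have "reduce_vec ?u + \<pi> (u $ k) *s ?w \<in> vec.span (insert ?w (reduction ?U))"
      by (rule vec.span_add)
    also have "reduce_vec ?u + \<pi> (u $ k) *s ?w = reduce_vec u"
      using u v by (simp add: vec_eq_iff reduce_vec_def hom_diff hom_mult mult_mem)
    finally show "reduce_vec u \<in> vec.span (insert ?w (reduction ?U))" .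
  qed
  ultimately have eq: "reduction U = vec.span (insert ?w (reduction ?U))" by blast
  have "vec.span (reduction ?U) = reduction ?U" unfolding reduction_def by (rule vec.span_span)
  then have "?w \<notin> vec.span (reduction ?U)" using notin by metis
  then have "vec.dim (reduction U) = Suc (vec.dim (reduction ?U))"
    unfolding eq vec.dim_span vec.dim_insert by (metis Suc_eq_plus1)
  moreover have "vec.dim (reduction ?U) = vec.dim ?U"
    using Suc.hyps(1)[OF _ sub] Suc.hyps(2) dim by simp
  ultimately show ?case using dim by simp
qed

text \<open>The column space of the reduced matrix always lies in the reduction of the column space.
  The rank assumption makes the two equal, and then the reduction of
  \<open>M \<inter> rng P\<close>, which has the same dimension as \<open>M \<inter> rng P\<close>,
  lies in the new intersection.\<close>

lemma solutions_reduction: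
  fixes M :: "('a ^ 'n::finite) set"
  assumes M: "M \<in> solutions C r"
    and mem: "\<And>P l i j. (P, l) \<in> C \<Longrightarrow> P $ i $ j \<in> O\<^sub>v"
    and dim: "\<And>P l. (P, l) \<in> C \<Longrightarrow> vec.dim (rng P) \<le> vec.dim (rng (map_matrix \<pi> P))"
  shows "reduction M \<in> solutions ((\<lambda>(P, l). (map_matrix \<pi> P, l)) ` C) r"
proof -
  have "l \<le> vec.dim (reduction M \<inter> rng (map_matrix \<pi> P))" if PC: "(P, l) \<in> C" for P l
  proof -
    have "column j (map_matrix \<pi> P) \<in> reduction (rng P)" for j
    proof -
      have "column j (map_matrix \<pi> P) = reduce_vec (column j P)"
        by (simp add: vec_eq_iff column_def reduce_vec_def)
      also have "\<dots> \<in> reduction (rng P)"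
        unfolding reduction_def using mem[OF PC] column_in_rng[of j P]
        by (intro vec.span_base) (auto simp: column_def)
      finally show ?thesis .
    qed
    then have "rng (map_matrix \<pi> P) \<subseteq> reduction (rng P)"
      by (simp add: rng_subset_iff_columns subspace_reduction)
    then have eq: "rng (map_matrix \<pi> P) = reduction (rng P)"
      using dim[OF PC] by (intro vec.subspace_dim_equal subspace_rng subspace_reduction)
        (simp_all add: dim_reduction subspace_rng)
    have "l \<le> vec.dim (M \<inter> rng P)" using M PC by (auto simp: solutions_def)
    also have "\<dots> = vec.dim (reduction (M \<inter> rng P))"
      using M by (simp add: dim_reduction vec.subspace_inter subspace_rng solutions_def)
    also have "\<dots> \<le> vec.dim (reduction M \<inter> rng (map_matrix \<pi> P))"
      unfolding eq by (rule vec.dim_subset) (simp add: reduction_mono)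
    finally show ?thesis .
  qed
  then show ?thesis
    using M by (auto simp: solutions_def subspace_reduction dim_reduction)
qed

end

text \<open>An element outside the first ring has an inverse with residue 0, which the second place
  sends to 0. If only the residue of \<open>x\<close> leaves the second ring, then \<open>x\<close>
  is a unit of the first, and the second place takes care of the inverse of its residue.\<close>

lemma place_comp:
  assumes "place O\<^sub>1 \<pi>\<^sub>1" and "place O\<^sub>2 \<pi>\<^sub>2"
  shows "place {x \<in> O\<^sub>1. \<pi>\<^sub>1 x \<in> O\<^sub>2} (\<pi>\<^sub>2 \<circ> \<pi>\<^sub>1)"
proof -
  interpret p1: place O\<^sub>1 \<pi>\<^sub>1 by fact
  interpret p2: place O\<^sub>2 \<pi>\<^sub>2 by fact
  have inv: "inverse x \<in> O\<^sub>1 \<and> \<pi>\<^sub>1 (inverse x) \<in> O\<^sub>2 \<and> \<pi>\<^sub>2 (\<pi>\<^sub>1 (inverse x)) = 0"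
    if "x \<in> O\<^sub>1 \<Longrightarrow> \<pi>\<^sub>1 x \<notin> O\<^sub>2" for x
  proof (cases "x \<in> O\<^sub>1")
    case True
    then have nz: "\<pi>\<^sub>1 x \<noteq> 0" using that p2.zero_mem by metis
    then have i: "inverse x \<in> O\<^sub>1" "x \<noteq> 0"
      using True p1.inverse_mem_if_unit p1.hom_zero by auto
    then have "\<pi>\<^sub>1 x * \<pi>\<^sub>1 (inverse x) = 1"
      using p1.hom_mult[OF True i(1)] p1.hom_one by simp
    then have "\<pi>\<^sub>1 (inverse x) = inverse (\<pi>\<^sub>1 x)" by (simp add: inverse_unique)
    then show ?thesis
      using i True that p2.inverse_mem p2.hom_inverse by metis
  next
    case False
    then show ?thesis using p1.inverse_mem p1.hom_inverse p2.zero_mem p2.hom_zero by metis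
  qed
  show ?thesis
    by unfold_locales
      (use inv in \<open>auto simp: p1.one_mem p1.hom_one p2.one_mem p2.hom_one p1.add_mem p1.hom_add
        p2.add_mem p2.hom_add p1.uminus_mem p1.hom_uminus p2.uminus_mem p2.hom_uminus p1.mult_mem
        p1.hom_mult p2.mult_mem p2.hom_mult\<close>)
qed

text \<open>The place lives on the localization of \<open>R\<close> at the kernel of
  \<open>h\<close>. Assumption \<open>frac\<close> makes it a valuation ring: if \<open>x\<close>
  lies outside, then \<open>h w = 0\<close> in the given fraction, so \<open>h u \<noteq> 0\<close>,
  and the inverse \<open>w / u\<close> has residue 0.\<close>

lemma ex_place_extending_hom:
  fixes h :: "'a::field \<Rightarrow> 'b::field"
  assumes hom: "ring_hom_on R h"
    and frac: "\<And>x. \<exists>u\<in>R. \<exists>w\<in>R. x * w = u \<and> (h u \<noteq> 0 \<or> h w \<noteq> 0)"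
  shows "\<exists>\<pi>. place {x. \<exists>u\<in>R. \<exists>w\<in>R. x * w = u \<and> h w \<noteq> 0} \<pi> \<and> (\<forall>x\<in>R. \<pi> x = h x)"
proof -
  interpret ring_hom_on R h by fact
  let ?O = "{x. \<exists>u\<in>R. \<exists>w\<in>R. x * w = u \<and> h w \<noteq> 0}"
  define \<pi> where "\<pi> x = (THE c. \<exists>w\<in>R. x * w \<in> R \<and> h w \<noteq> 0 \<and> c = h (x * w) / h w)" for x
  have eq: "\<pi> x = h (x * w) / h w" if w: "w \<in> R" "x * w \<in> R" "h w \<noteq> 0" for x w
    unfolding \<pi>_def
  proof (rule the_equality)
    show "\<exists>w'\<in>R. x * w' \<in> R \<and> h w' \<noteq> 0 \<and> h (x * w) / h w = h (x * w') / h w'"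
      using w by blast
    fix c assume "\<exists>w\<in>R. x * w \<in> R \<and> h w \<noteq> 0 \<and> c = h (x * w) / h w"
    then obtain w' where w': "w' \<in> R" "x * w' \<in> R" "h w' \<noteq> 0" "c = h (x * w') / h w'" by blast
    have "h (x * w) * h w' = h (x * w * w')" using w w' by (simp add: hom_mult)
    also have "x * w * w' = x * w' * w" by simp
    also have "h \<dots> = h (x * w') * h w" using w w' hom_mult by blast
    finally have "h (x * w) * h w' = h (x * w') * h w" .
    then show "c = h (x * w) / h w"
      unfolding w'(4) frac_eq_eq[OF w'(3) w(3)] by (rule sym)
  qed
  have eqR: "\<pi> x = h x" if "x \<in> R" for x
    using eq[of 1 x] that by (simp add: one_mem hom_one)
  have "place ?O \<pi>"
  proof
    show "1 \<in> ?O" using one_mem hom_one by fastforce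
    show "\<pi> 1 = 1" using eqR[OF one_mem] hom_one by simp
  next
    fix x y assume "x \<in> ?O" "y \<in> ?O"
    then obtain v w where vw: "v \<in> R" "x * v \<in> R" "h v \<noteq> 0" "w \<in> R" "y * w \<in> R" "h w \<noteq> 0" by blast
    have vw': "v * w \<in> R" "h (v * w) \<noteq> 0" using vw by (auto simp: mult_mem hom_mult)
    have a: "(x + y) * (v * w) = (x * v) * w + (y * w) * v" by (simp add: algebra_simps)
    have aR: "(x + y) * (v * w) \<in> R" unfolding a using vw by (simp add: mult_mem add_mem)
    show "x + y \<in> ?O" using aR vw' by blast
    have "\<pi> (x + y) = h ((x * v) * w + (y * w) * v) / h (v * w)"
      using eq[OF vw'(1) aR vw'(2)] a by simp
    also have "\<dots> = (h (x * v) * h w + h (y * w) * h v) / (h v * h w)"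
      using vw hom_add hom_mult mult_mem by metis
    also have "\<dots> = \<pi> x + \<pi> y" using vw by (simp add: eq field_simps)
    finally show "\<pi> (x + y) = \<pi> x + \<pi> y" .
    have m: "(x * y) * (v * w) = (x * v) * (y * w)" by (simp add: algebra_simps)
    have mR: "(x * y) * (v * w) \<in> R" unfolding m using vw by (simp add: mult_mem)
    show "x * y \<in> ?O" using mR vw' by blast
    have "\<pi> (x * y) = h ((x * v) * (y * w)) / h (v * w)"
      using eq[OF vw'(1) mR vw'(2)] m by simp
    also have "\<dots> = (h (x * v) * h (y * w)) / (h v * h w)"
      using vw hom_mult by metis
    also have "\<dots> = \<pi> x * \<pi> y" using vw by (simp add: eq)
    finally show "\<pi> (x * y) = \<pi> x * \<pi> y" .
  next
    fix x assume "x \<in> ?O"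
    then obtain w where "w \<in> R" "x * w \<in> R" "h w \<noteq> 0" by blast
    then show "- x \<in> ?O" using uminus_mem by fastforce
  next
    fix x assume x: "x \<notin> ?O"
    obtain w where w: "w \<in> R" "x * w \<in> R" "h (x * w) \<noteq> 0 \<or> h w \<noteq> 0" using frac by blast
    with x have hw: "h w = 0" "h (x * w) \<noteq> 0" by auto
    then have "x \<noteq> 0" using hom_zero by auto
    then have i: "inverse x * (x * w) = w" by simp
    show "inverse x \<in> ?O" using i w hw by blast
    have "inverse x * (x * w) \<in> R" unfolding i by (rule w(1))
    from eq[OF w(2) this hw(2)] show "\<pi> (inverse x) = 0" using i hw by simp
  qed
  then show ?thesis using eqR by blast
qed

section \<open>Extending homomorphisms into the complex numbers\<close>

context ring_hom_on
begin

text \<open>\<open>T\<close> is a set and not a type, so the polynomial ring over it is a subset of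
  \<open>'a poly\<close>.\<close>

definition coeffs_in :: "'a poly \<Rightarrow> bool" where
  "coeffs_in f \<longleftrightarrow> (\<forall>i. coeff f i \<in> T)"

abbreviation map_hom :: "'a poly \<Rightarrow> 'b poly" where
  "map_hom \<equiv> map_poly \<sigma>"

lemma coeff_map_hom: "coeff (map_hom f) i = \<sigma> (coeff f i)"
  by (simp add: coeff_map_poly hom_zero)

lemma coeffs_in_pCons: "c \<in> T \<Longrightarrow> coeffs_in f \<Longrightarrow> coeffs_in (pCons c f)"
  by (auto simp: coeffs_in_def coeff_pCons split: nat.split)

lemma coeffs_in_0: "coeffs_in 0"
  by (simp add: coeffs_in_def zero_mem)

lemma coeffs_in_const: "c \<in> T \<Longrightarrow> coeffs_in [:c:]"
  by (simp add: coeffs_in_pCons coeffs_in_0)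

lemma coeffs_in_add: "coeffs_in f \<Longrightarrow> coeffs_in g \<Longrightarrow> coeffs_in (f + g)"
  by (simp add: coeffs_in_def add_mem)

lemma coeffs_in_uminus: "coeffs_in f \<Longrightarrow> coeffs_in (- f)"
  by (simp add: coeffs_in_def uminus_mem)

lemma coeffs_in_diff: "coeffs_in f \<Longrightarrow> coeffs_in g \<Longrightarrow> coeffs_in (f - g)"
  by (simp add: coeffs_in_def diff_mem)

lemma coeffs_in_mult: "coeffs_in f \<Longrightarrow> coeffs_in g \<Longrightarrow> coeffs_in (f * g)"
  by (simp add: coeffs_in_def coeff_mult sum_mem mult_mem)

lemma coeffs_in_smult: "c \<in> T \<Longrightarrow> coeffs_in f \<Longrightarrow> coeffs_in (smult c f)"
  by (simp add: coeffs_in_def mult_mem)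

lemma coeffs_in_monom: "c \<in> T \<Longrightarrow> coeffs_in (monom c n)"
  by (simp add: coeffs_in_def zero_mem)

lemmas coeffs_in_intros = coeffs_in_0 coeffs_in_const coeffs_in_add coeffs_in_uminus coeffs_in_diff
  coeffs_in_mult coeffs_in_smult coeffs_in_monom

lemma map_hom_add: "coeffs_in f \<Longrightarrow> coeffs_in g \<Longrightarrow> map_hom (f + g) = map_hom f + map_hom g"
  by (rule poly_eqI) (simp add: coeff_map_hom coeffs_in_def hom_add)

lemma map_hom_diff: "coeffs_in f \<Longrightarrow> coeffs_in g \<Longrightarrow> map_hom (f - g) = map_hom f - map_hom g"
  by (rule poly_eqI) (simp add: coeff_map_hom coeffs_in_def hom_diff)

lemma map_hom_mult: "coeffs_in f \<Longrightarrow> coeffs_in g \<Longrightarrow> map_hom (f * g) = map_hom f * map_hom g"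
  by (rule poly_eqI) (simp add: coeff_map_hom coeffs_in_def coeff_mult hom_sum hom_mult mult_mem)

lemma map_hom_smult: "c \<in> T \<Longrightarrow> coeffs_in f \<Longrightarrow> map_hom (smult c f) = smult (\<sigma> c) (map_hom f)"
  by (rule poly_eqI) (simp add: coeff_map_hom coeffs_in_def hom_mult)

lemma map_hom_const: "map_hom [:c:] = [:\<sigma> c:]"
  by (simp add: map_poly_pCons hom_zero)

definition adjoin :: "'a \<Rightarrow> 'a set" where
  "adjoin z = {poly f z |f. coeffs_in f}"

lemma subset_adjoin: "T \<subseteq> adjoin z"
proof
  fix x assume "x \<in> T"
  then have "coeffs_in [:x:]" by (rule coeffs_in_const)
  moreover have "x = poly [:x:] z" by simp
  ultimately show "x \<in> adjoin z" unfolding adjoin_def by blast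
qed

lemma coeffs_in_X: "coeffs_in [:0, 1:]"
  by (simp add: coeffs_in_pCons zero_mem one_mem coeffs_in_0)

lemma mem_adjoin: "z \<in> adjoin z"
proof -
  have "z = poly [:0, 1:] z" by simp
  then show ?thesis unfolding adjoin_def using coeffs_in_X by blast
qed

lemma countable_coeffs_in:
  assumes "countable T"
  shows "countable {f. coeffs_in f}"
proof (rule countable_subset)
  show "countable (Poly ` lists T)" using assms by simp
  show "{f. coeffs_in f} \<subseteq> Poly ` lists T"
  proof safe
    fix f assume "coeffs_in f"
    then have "coeffs f \<in> lists T" by (auto simp: coeffs_in_def coeffs_def)
    then show "f \<in> Poly ` lists T" by (metis Poly_coeffs imageI)
  qed
qed

lemma countable_adjoin: "countable T \<Longrightarrow> countable (adjoin z)"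
  unfolding adjoin_def using countable_image[OF countable_coeffs_in]
  by (simp add: setcompr_eq_image)

text \<open>Assumption \<open>root\<close> says that \<open>w\<close> satisfies every relation of
  \<open>z\<close>; hence the value at \<open>poly f z\<close> does not depend on the choice of
  \<open>f\<close>.\<close>

lemma hom_extend_adjoin:
  assumes root: "\<And>f. coeffs_in f \<Longrightarrow> poly f z = 0 \<Longrightarrow> poly (map_hom f) w = 0"
  shows "\<exists>\<tau>. ring_hom_on (adjoin z) \<tau> \<and> (\<forall>f. coeffs_in f \<longrightarrow> \<tau> (poly f z) = poly (map_hom f) w)"
proof -
  define \<tau> where "\<tau> x = poly (map_hom (SOME f. coeffs_in f \<and> poly f z = x)) w" for x
  have eq: "\<tau> (poly f z) = poly (map_hom f) w" if f: "coeffs_in f" for f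
  proof -
    let ?g = "SOME g. coeffs_in g \<and> poly g z = poly f z"
    have g: "coeffs_in ?g \<and> poly ?g z = poly f z"
      by (rule someI[of _ f]) (simp add: f)
    then have "poly (map_hom (?g - f)) w = 0"
      using f by (intro root) (auto simp: coeffs_in_diff)
    then show ?thesis using f g by (simp add: \<tau>_def map_hom_diff)
  qed
  have "ring_hom_on (adjoin z) \<tau>"
  proof
    show "1 \<in> adjoin z" using subset_adjoin one_mem by blast
    show "\<tau> 1 = 1" using eq[OF coeffs_in_const[OF one_mem]] by (simp add: map_hom_const hom_one)
  next
    fix x y assume "x \<in> adjoin z" "y \<in> adjoin z"
    then obtain f g where fg: "x = poly f z" "coeffs_in f" "y = poly g z" "coeffs_in g"
      by (auto simp: adjoin_def)
    have s: "x + y = poly (f + g) z" and m: "x * y = poly (f * g) z" using fg by simp_all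
    show "x + y \<in> adjoin z" unfolding s adjoin_def using fg coeffs_in_add by blast
    show "x * y \<in> adjoin z" unfolding m adjoin_def using fg coeffs_in_mult by blast
    show "\<tau> (x + y) = \<tau> x + \<tau> y"
      using fg eq[OF coeffs_in_add[OF fg(2,4)]] eq by (simp add: map_hom_add)
    show "\<tau> (x * y) = \<tau> x * \<tau> y"
      using fg eq[OF coeffs_in_mult[OF fg(2,4)]] eq by (simp add: map_hom_mult)
  next
    fix x assume "x \<in> adjoin z"
    then obtain f where "x = poly f z" "coeffs_in f" by (auto simp: adjoin_def)
    then have "- x = poly (- f) z" "coeffs_in (- f)" by (auto simp: coeffs_in_uminus)
    then show "- x \<in> adjoin z" unfolding adjoin_def by blast
  qed
  then show ?thesis using eq by blast
qed

text \<open>\<open>T\<close> need not contain the inverse of the leading coefficient of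
  \<open>g\<close>, so the dividend is multiplied by a constant instead.\<close>

lemma ex_pseudo_division:
  assumes "coeffs_in f" and g: "coeffs_in g" "g \<noteq> 0"
  shows "\<exists>c\<in>T. c \<noteq> 0 \<and> (\<exists>q r. coeffs_in q \<and> coeffs_in r \<and> smult c f = q * g + r \<and>
           (r = 0 \<or> degree r < degree g))"
  using assms(1)
\<comment> \<open>The measure separates 0 from the nonzero constants, which have the same degree; if
  both \<open>f\<close> and \<open>g\<close> are constants, a division step leads from one to the
  other.\<close>
proof (induction "if f = 0 then 0 else Suc (degree f)" arbitrary: f rule: less_induct)
  case less
  show ?case
  proof (cases "f = 0 \<or> degree f < degree g")
    case True
    then have "smult 1 f = 0 * g + f \<and> (f = 0 \<or> degree f < degree g)" by simp
    then show ?thesis using one_mem less.prems coeffs_in_0 zero_neq_one by metis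
  next
    case False
    then have f: "f \<noteq> 0" "degree g \<le> degree f" by auto
    let ?m = "monom (lead_coeff f) (degree f - degree g)"
    let ?f = "smult (lead_coeff g) f - ?m * g"
    have lc: "lead_coeff f \<in> T" "lead_coeff g \<in> T"
      using less.prems g by (auto simp: coeffs_in_def)
    have m: "coeffs_in ?m" using lc by (simp add: coeffs_in_monom)
    have f': "coeffs_in ?f" using less.prems lc g m by (intro coeffs_in_intros)
    have degm: "degree (?m * g) = degree f"
      using f g by (simp add: degree_mult_eq degree_monom_eq)
    have "degree ?f \<le> degree f"
      using degm by (metis degree_diff_le degree_smult_le order_refl)
    moreover have "coeff (?m * g) (degree f) = lead_coeff f * lead_coeff g"
      using degm lead_coeff_mult[of ?m g] by (metis lead_coeff_monom)
    then have "coeff ?f (degree f) = 0" by simp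
    ultimately have "?f = 0 \<or> degree ?f < degree f"
      by (metis leading_coeff_0_iff le_neq_implies_less)
    then have "(if ?f = 0 then 0 else Suc (degree ?f)) < (if f = 0 then 0 else Suc (degree f))"
      using f by auto
    from less.hyps[OF this f'] obtain c q r where c: "c \<in> T" "c \<noteq> 0" "coeffs_in q" "coeffs_in r"
      "smult c ?f = q * g + r" "r = 0 \<or> degree r < degree g" by blast
    have "smult (c * lead_coeff g) f = (q + smult c ?m) * g + r"
      using c(5) by (simp add: smult_diff_right algebra_simps)
    moreover have "c * lead_coeff g \<in> T" "c * lead_coeff g \<noteq> 0"
      using c lc g by (auto simp: mult_mem)
    moreover have "coeffs_in (q + smult c ?m)"
      by (intro coeffs_in_add coeffs_in_smult c(1,3) m)
    ultimately show ?thesis using c(4,6) by blast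
  qed
qed

text \<open>Least degree replaces being monic and irreducible, since leading coefficients need not
  be invertible in \<open>T\<close>.\<close>

definition min_poly :: "'a \<Rightarrow> 'a poly \<Rightarrow> bool" where
  "min_poly z g \<longleftrightarrow> coeffs_in g \<and> g \<noteq> 0 \<and> poly g z = 0 \<and>
     (\<forall>f. coeffs_in f \<longrightarrow> f \<noteq> 0 \<longrightarrow> poly f z = 0 \<longrightarrow> degree g \<le> degree f)"

lemma ex_min_poly:
  assumes "coeffs_in f" "f \<noteq> 0" "poly f z = 0"
  shows "\<exists>g. min_poly z g"
proof -
  obtain g where "coeffs_in g \<and> g \<noteq> 0 \<and> poly g z = 0"
    "\<And>f. coeffs_in f \<and> f \<noteq> 0 \<and> poly f z = 0 \<Longrightarrow> degree g \<le> degree f"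
    using ex_has_least_nat[of "\<lambda>f. coeffs_in f \<and> f \<noteq> 0 \<and> poly f z = 0" f degree] assms by blast
  then show ?thesis unfolding min_poly_def by blast
qed

lemma degree_min_poly_pos: "min_poly z g \<Longrightarrow> 0 < degree g"
  unfolding min_poly_def by (metis gr0I degree_eq_zeroE poly_const_conv pCons_0_0)

context
  assumes kernel: "\<And>x. x \<in> T \<Longrightarrow> \<sigma> x = 0 \<Longrightarrow> x = 0"
begin

lemma degree_map_hom: "coeffs_in f \<Longrightarrow> degree (map_hom f) = degree f"
proof (cases "f = 0")
  case False
  assume "coeffs_in f"
  then have "\<sigma> (lead_coeff f) \<noteq> 0" using False kernel[of "lead_coeff f"] by (auto simp: coeffs_in_def)
  then show ?thesis by (intro map_poly_degree_eq)
qed simp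

text \<open>If \<open>f\<close> vanishes at \<open>z\<close>, then \<open>g\<close> divides a
  multiple of \<open>f\<close>. For the converse, the gcd \<open>h\<close> of \<open>f\<close> and
  \<open>g\<close> has an image that vanishes at \<open>w\<close>. If \<open>f\<close> did not
  vanish at \<open>z\<close>, neither would \<open>h\<close>, so the cofactor of \<open>h\<close> in
  \<open>g\<close> would; by minimality of \<open>g\<close>, \<open>h\<close> would be a nonzero
  constant, whose image cannot vanish.\<close>

lemma poly_map_hom_eq_0_iff_if_algebraic:
  assumes g: "min_poly z g" and w: "poly (map_hom g) w = 0" and f: "coeffs_in f"
  shows "poly (map_hom f) w = 0 \<longleftrightarrow> poly f z = 0"
proof
  have gT: "coeffs_in g" "g \<noteq> 0" "poly g z = 0"
    and min: "\<And>f. coeffs_in f \<Longrightarrow> f \<noteq> 0 \<Longrightarrow> poly f z = 0 \<Longrightarrow> degree g \<le> degree f"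
    using g by (auto simp: min_poly_def)
  {
    assume z: "poly f z = 0"
    obtain c q r where c: "c \<in> T" "c \<noteq> 0" "coeffs_in q" "coeffs_in r"
      "smult c f = q * g + r" "r = 0 \<or> degree r < degree g"
      using ex_pseudo_division[OF f gT(1,2)] by blast
    have "c * poly f z = poly q z * poly g z + poly r z"
      using arg_cong[OF c(5), of "\<lambda>p. poly p z"] by simp
    then have "poly r z = 0" using z gT by simp
    then have "r = 0" using c(4,6) min[of r] by fastforce
    then have "map_hom (smult c f) = map_hom (q * g)" using c(5) by simp
    then have "smult (\<sigma> c) (map_hom f) = map_hom q * map_hom g"
      unfolding map_hom_smult[OF c(1) f] map_hom_mult[OF c(3) gT(1)] .
    from arg_cong[OF this, of "\<lambda>p. poly p w"]
    have "\<sigma> c * poly (map_hom f) w = poly (map_hom q) w * poly (map_hom g) w" by simp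
    then have "\<sigma> c * poly (map_hom f) w = 0" using w by simp
    moreover have "\<sigma> c \<noteq> 0" using c kernel by blast
    ultimately show "poly (map_hom f) w = 0" by simp
  }
  assume fw: "poly (map_hom f) w = 0"
  \<comment> \<open>The ideal generated by \<open>f\<close> and \<open>g\<close>. A nonzero element
    of least degree divides each member of it up to a nonzero factor from \<open>T\<close>.\<close>
  let ?J = "\<lambda>h. \<exists>s t. coeffs_in s \<and> coeffs_in t \<and> h = s * f + t * g"
  have J_in: "coeffs_in h" if "?J h" for h
    using that f gT by (auto intro: coeffs_in_add coeffs_in_mult)
  have "?J g"
    using coeffs_in_0 coeffs_in_const[OF one_mem]
    by (intro exI[of _ 0] exI[of _ "[:1:]"]) simp
  have "?J f"
    using coeffs_in_0 coeffs_in_const[OF one_mem]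
    by (intro exI[of _ 0] exI[of _ "[:1:]"]) (simp add: exI[of _ 0])
  obtain h where h: "?J h" "h \<noteq> 0" and hmin: "\<And>k. ?J k \<Longrightarrow> k \<noteq> 0 \<Longrightarrow> degree h \<le> degree k"
    using ex_has_least_nat[of "\<lambda>h. ?J h \<and> h \<noteq> 0" g degree] \<open>?J g\<close> gT(2) by blast
  have hT: "coeffs_in h" using J_in h(1) by blast
  have dvd: "\<exists>c\<in>T. c \<noteq> 0 \<and> (\<exists>q. coeffs_in q \<and> smult c k = q * h)" if k: "?J k" for k
  proof -
    obtain c q r where c: "c \<in> T" "c \<noteq> 0" "coeffs_in q" "coeffs_in r"
      "smult c k = q * h + r" "r = 0 \<or> degree r < degree h"
      using ex_pseudo_division[OF J_in[OF k] hT h(2)] by blast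
    obtain s t where st: "coeffs_in s" "coeffs_in t" "k = s * f + t * g" using k by blast
    obtain s' t' where st': "coeffs_in s'" "coeffs_in t'" "h = s' * f + t' * g" using h by blast
    have "r = smult c k - q * h" using c(5) by simp
    also have "\<dots> = (smult c s - q * s') * f + (smult c t - q * t') * g"
      unfolding st st' by (simp add: algebra_simps smult_add_right)
    finally have "r = (smult c s - q * s') * f + (smult c t - q * t') * g" .
    moreover have "coeffs_in (smult c s - q * s')" "coeffs_in (smult c t - q * t')"
      by (intro coeffs_in_diff coeffs_in_smult coeffs_in_mult c(1,3) st(1,2) st'(1,2))+
    ultimately have "?J r" by blast
    then have "r = 0" using hmin[of r] c(6) by fastforce
    then show ?thesis using c by auto
  qed
  have hw: "poly (map_hom h) w = 0"
  proof -
    obtain s t where "coeffs_in s" "coeffs_in t" "h = s * f + t * g" using h by blast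
    then show ?thesis
      using f gT fw w by (simp add: map_hom_add map_hom_mult coeffs_in_mult)
  qed
  show "poly f z = 0"
  proof (rule ccontr)
    assume fz: "poly f z \<noteq> 0"
    obtain c q where c: "c \<noteq> 0" "smult c f = q * h" using dvd[OF \<open>?J f\<close>] by blast
    have "c * poly f z = poly q z * poly h z"
      using arg_cong[OF c(2), of "\<lambda>p. poly p z"] by simp
    then have hz: "poly h z \<noteq> 0" using c(1) fz by auto
    obtain d p where d: "d \<noteq> 0" "coeffs_in p" "smult d g = p * h" using dvd[OF \<open>?J g\<close>] by blast
    have "d * poly g z = poly p z * poly h z"
      using arg_cong[OF d(3), of "\<lambda>p. poly p z"] by simp
    then have "poly p z = 0" using gT hz by simp
    moreover have "p \<noteq> 0" using d gT by auto
    ultimately have "degree g \<le> degree p" using d(2) min by blast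
    moreover have "degree g = degree p + degree h"
      using d \<open>p \<noteq> 0\<close> h(2) by (metis degree_mult_eq degree_smult_eq)
    ultimately have "degree h = 0" by simp
    then obtain b where b: "h = [:b:]" by (rule degree_eq_zeroE)
    then have "b \<in> T" using hT by (auto simp: coeffs_in_def dest: spec[of _ 0])
    moreover have "\<sigma> b = 0" using hw b by (simp add: map_hom_const)
    ultimately have "b = 0" by (rule kernel)
    then show False using h(2) b by simp
  qed
qed

lemma poly_map_hom_eq_0_iff_if_transcendental:
  assumes "\<And>f. coeffs_in f \<Longrightarrow> f \<noteq> 0 \<Longrightarrow> poly f z \<noteq> 0"
    and "\<And>f. coeffs_in f \<Longrightarrow> f \<noteq> 0 \<Longrightarrow> poly (map_hom f) w \<noteq> 0" and "coeffs_in f"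
  shows "poly (map_hom f) w = 0 \<longleftrightarrow> poly f z = 0"
  using assms by (cases "f = 0") auto

text \<open>One direction of \<open>iff\<close> makes the extension well defined, the other makes it
  injective.\<close>

lemma hom_extend_adjoin_inj:
  assumes iff: "\<And>f. coeffs_in f \<Longrightarrow> poly (map_hom f) w = 0 \<longleftrightarrow> poly f z = 0"
  shows "\<exists>\<tau>. ring_hom_on (adjoin z) \<tau> \<and> (\<forall>x\<in>adjoin z. \<tau> x = 0 \<longrightarrow> x = 0) \<and>
           (\<forall>x\<in>T. \<tau> x = \<sigma> x) \<and> \<tau> z = w"
proof -
  obtain \<tau> where \<tau>: "ring_hom_on (adjoin z) \<tau>"
    "\<And>f. coeffs_in f \<Longrightarrow> \<tau> (poly f z) = poly (map_hom f) w"
    using hom_extend_adjoin[of z w] iff by blast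
  have "\<tau> x = \<sigma> x" if "x \<in> T" for x
    using \<tau>(2)[OF coeffs_in_const[OF that]] by (simp add: map_hom_const)
  moreover have "\<tau> z = w"
    using \<tau>(2)[OF coeffs_in_X] by (simp add: map_poly_pCons hom_zero hom_one)
  moreover have "\<forall>x\<in>adjoin z. \<tau> x = 0 \<longrightarrow> x = 0"
    using \<tau>(2) iff by (auto simp: adjoin_def)
  ultimately show ?thesis using \<tau>(1) by blast
qed

end

end

text \<open>Uncountability of \<complex> does the work of a transcendence basis: transcendental
  images can be picked over any countable subring. The point \<open>z\<close> is excluded so that a
  transcendental element can be moved.\<close>

lemma ex_not_root_of_countably_many:
  fixes F :: "complex poly set"
  assumes "countable F"
  shows "\<exists>w. w \<noteq> z \<and> (\<forall>f\<in>F. f \<noteq> 0 \<longrightarrow> poly f w \<noteq> 0)"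
proof -
  have "countable (insert z (\<Union>f\<in>F - {0}. {w. poly f w = 0}))"
    using assms by (auto intro: countable_finite poly_roots_finite)
  then have "insert z (\<Union>f\<in>F - {0}. {w. poly f w = 0}) \<noteq> UNIV"
    using uncountable_UNIV_complex by metis
  then show ?thesis by auto
qed

text \<open>An algebraic \<open>z\<close> goes to a root of the image of its minimal polynomial, a
  transcendental one to a number transcendental over the countable image of
  \<open>T\<close>.\<close>

lemma hom_extend_element:
  fixes \<sigma> :: "complex \<Rightarrow> complex"
  assumes "ring_hom_on T \<sigma>" and ker: "\<And>x. x \<in> T \<Longrightarrow> \<sigma> x = 0 \<Longrightarrow> x = 0" and "countable T"
  shows "\<exists>T' \<tau>. ring_hom_on T' \<tau> \<and> (\<forall>x\<in>T'. \<tau> x = 0 \<longrightarrow> x = 0) \<and> countable T' \<and>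
           insert z T \<subseteq> T' \<and> (\<forall>x\<in>T. \<tau> x = \<sigma> x)"
proof -
  interpret ring_hom_on T \<sigma> by fact
  have "\<exists>w. \<forall>f. coeffs_in f \<longrightarrow> (poly (map_hom f) w = 0 \<longleftrightarrow> poly f z = 0)"
  proof (cases "\<exists>f. coeffs_in f \<and> f \<noteq> 0 \<and> poly f z = 0")
    case True
    then obtain g where g: "min_poly z g" using ex_min_poly by blast
    then have "degree (map_hom g) > 0"
      using degree_map_hom[OF ker] degree_min_poly_pos by (auto simp: min_poly_def)
    then obtain w where "poly (map_hom g) w = 0" using alg_closed_imp_poly_has_root by blast
    then show ?thesis using poly_map_hom_eq_0_iff_if_algebraic[OF ker g] by blast
  next
    case False
    obtain w where w: "\<forall>f\<in>map_hom ` {f. coeffs_in f}. f \<noteq> 0 \<longrightarrow> poly f w \<noteq> 0"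
      using ex_not_root_of_countably_many[OF countable_image[OF countable_coeffs_in[OF assms(3)]]]
      by metis
    have "map_hom f \<noteq> 0" if "coeffs_in f" "f \<noteq> 0" for f
    proof -
      have "\<sigma> (lead_coeff f) \<noteq> 0" using that ker[of "lead_coeff f"] by (auto simp: coeffs_in_def)
      then show ?thesis by (metis coeff_map_hom coeff_0)
    qed
    then show ?thesis
      using poly_map_hom_eq_0_iff_if_transcendental[OF ker, of z w] False w by blast
  qed
  then obtain w where "\<And>f. coeffs_in f \<Longrightarrow> poly (map_hom f) w = 0 \<longleftrightarrow> poly f z = 0" by blast
  from hom_extend_adjoin_inj[OF ker this] obtain \<tau> where
    "ring_hom_on (adjoin z) \<tau>" "\<forall>x\<in>adjoin z. \<tau> x = 0 \<longrightarrow> x = 0" "\<forall>x\<in>T. \<tau> x = \<sigma> x" by blast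
  then show ?thesis
    using countable_adjoin[OF assms(3)] mem_adjoin[of z] subset_adjoin[of z] by blast
qed

text \<open>A certificate involves finitely many numbers, so finitely many extension steps suffice
  and no homomorphism on all of \<complex> has to be built.\<close>

lemma hom_extend_finite:
  fixes \<sigma> :: "complex \<Rightarrow> complex"
  assumes "finite B" "ring_hom_on T \<sigma>" and "\<And>x. x \<in> T \<Longrightarrow> \<sigma> x = 0 \<Longrightarrow> x = 0" and "countable T"
  shows "\<exists>T' \<tau>. ring_hom_on T' \<tau> \<and> (\<forall>x\<in>T'. \<tau> x = 0 \<longrightarrow> x = 0) \<and> countable T' \<and>
           B \<union> T \<subseteq> T' \<and> (\<forall>x\<in>T. \<tau> x = \<sigma> x)"
  using assms
proof (induction B arbitrary: T \<sigma> rule: finite_induct)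
  case empty
  then show ?case by (intro exI[of _ T] exI[of _ \<sigma>]) auto
next
  case (insert z B)
  obtain T1 \<tau>1 where 1: "ring_hom_on T1 \<tau>1" "\<forall>x\<in>T1. \<tau>1 x = 0 \<longrightarrow> x = 0" "countable T1"
    "insert z T \<subseteq> T1" "\<forall>x\<in>T. \<tau>1 x = \<sigma> x"
    using hom_extend_element[OF insert.prems, of z] by blast
  have ker: "\<And>x. x \<in> T1 \<Longrightarrow> \<tau>1 x = 0 \<Longrightarrow> x = 0" using 1(2) by blast
  obtain T2 \<tau>2 where 2: "ring_hom_on T2 \<tau>2" "\<forall>x\<in>T2. \<tau>2 x = 0 \<longrightarrow> x = 0" "countable T2"
    "B \<union> T1 \<subseteq> T2" "\<forall>x\<in>T1. \<tau>2 x = \<tau>1 x"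
    using insert.IH[OF 1(1) ker 1(3)] by blast
  show ?case
    by (intro exI[of _ T2] exI[of _ \<tau>2]) (use 1 2 in auto)
qed

text \<open>The conjugates of \<open>z\<close> are the roots of its minimal polynomial, which are simple.\<close>

lemma ex_hom_moving:
  fixes S :: "complex set"
  assumes S: "ring_hom_on S (\<lambda>x. x)" and inv: "\<And>x. x \<in> S \<Longrightarrow> inverse x \<in> S"
    and "countable S" and z: "z \<notin> S" and "finite B"
  shows "\<exists>T \<tau>. ring_hom_on T \<tau> \<and> B \<union> insert z S \<subseteq> T \<and> (\<forall>x\<in>S. \<tau> x = x) \<and> \<tau> z \<noteq> z"
proof -
  interpret ring_hom_on S "\<lambda>x. x" by fact
  \<comment> \<open>The injectivity assumption of the preceding lemmas, for the identity on
    \<open>S\<close>.\<close>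
  have ker: "x = 0" if "x = 0" for x :: complex using that .
  have "\<exists>w. w \<noteq> z \<and> (\<forall>f. coeffs_in f \<longrightarrow> (poly (map_hom f) w = 0 \<longleftrightarrow> poly f z = 0))"
  proof (cases "\<exists>f. coeffs_in f \<and> f \<noteq> 0 \<and> poly f z = 0")
    case True
    then obtain g where g: "min_poly z g" using ex_min_poly by blast
    have gS: "coeffs_in g" "g \<noteq> 0" "poly g z = 0"
      and min: "\<And>f. coeffs_in f \<Longrightarrow> f \<noteq> 0 \<Longrightarrow> poly f z = 0 \<Longrightarrow> degree g \<le> degree f"
      using g by (auto simp: min_poly_def)
    \<comment> \<open>Here closure of \<open>S\<close> under inverses enters: degree 1 would put
      \<open>z\<close> into \<open>S\<close>.\<close>
    have deg: "degree g \<noteq> 1"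
    proof
      assume d: "degree g = 1"
      then have "coeff g 0 + coeff g 1 * z = 0" using gS(3) by (simp add: poly_altdef)
      moreover have nz: "coeff g 1 \<noteq> 0" using gS(2) d by (metis leading_coeff_0_iff)
      ultimately have "z = - coeff g 0 * inverse (coeff g 1)"
        by (simp add: field_simps eq_neg_iff_add_eq_0)
      moreover have "coeff g 0 \<in> S" "coeff g 1 \<in> S" using gS(1) by (auto simp: coeffs_in_def)
      ultimately show False using z inv mult_mem uminus_mem by blast
    qed
    have dpos: "degree g > 0" by (rule degree_min_poly_pos[OF g])
    have "coeffs_in (pderiv g)"
    proof -
      have "of_nat k \<in> S" for k :: nat
        by (induction k) (auto simp: zero_mem one_mem add_mem)
      then show ?thesis
        using gS(1) mult_mem by (simp add: coeffs_in_def coeff_pderiv del: of_nat_Suc)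
    qed
    moreover have "pderiv g \<noteq> 0" "degree (pderiv g) < degree g"
      using dpos by (auto simp: pderiv_eq_0_iff degree_pderiv)
    \<comment> \<open>In characteristic 0 the derivative is a nonzero polynomial of smaller degree,
      so by minimality it does not vanish at \<open>z\<close>. Its value there is that of the
      cofactor \<open>q\<close> below, whose roots therefore differ from \<open>z\<close>.\<close>
    ultimately have dz: "poly (pderiv g) z \<noteq> 0" using min[of "pderiv g"] by fastforce
    obtain q where q: "g = [:- z, 1:] * q" using gS(3) by (metis poly_eq_0_iff_dvd dvdE)
    have "pderiv g = q + [:- z, 1:] * pderiv q"
      unfolding q pderiv_mult by (simp add: pderiv_pCons)
    then have "poly (pderiv g) z = poly q z" by simp
    then have "poly q z \<noteq> 0" using dz by simp
    moreover have "q \<noteq> 0" using q gS(2) by auto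
    then have "degree g = degree [:- z, 1:] + degree q"
      unfolding q by (intro degree_mult_eq) auto
    then have "degree q > 0" using deg by simp
    then obtain w where "poly q w = 0" using alg_closed_imp_poly_has_root by blast
    ultimately have w: "w \<noteq> z" "poly (map_hom g) w = 0" using q by auto
    then show ?thesis using poly_map_hom_eq_0_iff_if_algebraic[OF ker g w(2)] by blast
  next
    case False
    obtain w where w: "w \<noteq> z" "\<forall>f\<in>{f. coeffs_in f}. f \<noteq> 0 \<longrightarrow> poly f w \<noteq> 0"
      using ex_not_root_of_countably_many[OF countable_coeffs_in[OF assms(3)], of z] by metis
    then show ?thesis using False by (intro exI[of _ w]) auto
  qed
  then obtain w where w: "w \<noteq> z" "\<And>f. coeffs_in f \<Longrightarrow> poly (map_hom f) w = 0 \<longleftrightarrow> poly f z = 0"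
    by blast
  obtain \<tau> where \<tau>: "ring_hom_on (adjoin z) \<tau>" "\<forall>x\<in>adjoin z. \<tau> x = 0 \<longrightarrow> x = 0"
    "\<forall>x\<in>S. \<tau> x = x" "\<tau> z = w"
    using hom_extend_adjoin_inj[OF ker w(2)] by blast
  have ker': "\<And>x. x \<in> adjoin z \<Longrightarrow> \<tau> x = 0 \<Longrightarrow> x = 0" using \<tau>(2) by blast
  obtain T \<tau>' where T: "ring_hom_on T \<tau>'" "B \<union> adjoin z \<subseteq> T" "\<forall>x\<in>adjoin z. \<tau>' x = \<tau> x"
    using hom_extend_finite[OF assms(5) \<tau>(1) ker' countable_adjoin[OF assms(3)]] by blast
  show ?thesis
    using T \<tau> w(1) mem_adjoin[of z] subset_adjoin[of z] by (intro exI[of _ T] exI[of _ \<tau>']) auto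
qed

section \<open>Rationality of a unique solution\<close>

text \<open>By the exchange lemma some coordinate vectors span a complement of \<open>M\<close>.
  Homomorphisms applied to the entries fix such a complement, so the projector along it is a
  canonical matrix for \<open>M\<close>, that is, its coordinates in an affine chart of the
  Grassmannian.\<close>

lemma ex_projector:
  fixes M :: "('a::field ^ 'n::finite) set"
  assumes M: "vec.subspace M"
  shows "\<exists>(Q :: 'a ^ 'n ^ 'n) K. rng Q = M \<and> (\<forall>x\<in>M. Q *v x = x) \<and> (\<forall>k\<in>K. Q *v axis k 1 = 0) \<and>
           vec.span (M \<union> (\<lambda>k. axis k 1) ` K) = UNIV"
proof -
  obtain B where B: "B \<subseteq> M" "vec.independent B" "M \<subseteq> vec.span B"
    using vec.basis_exists by metis
  obtain B' where B': "B \<subseteq> B'" "B' \<subseteq> B \<union> cart_basis" "vec.independent B'"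
    "B \<union> cart_basis \<subseteq> vec.span B'"
    using vec.maximal_independent_subset_extend[of B "B \<union> cart_basis"] B(2) by blast
  have span: "vec.span B' = UNIV"
    using B'(4) span_cart_basis vec.span_mono[of cart_basis "vec.span B'"]
    by (auto simp: vec.span_span)
  obtain g where g: "Vector_Spaces.linear (*s) (*s) g" "\<forall>b\<in>B'. g b = (if b \<in> B then b else 0)"
    using vec.linear_independent_extend[OF B'(3), of "\<lambda>b. if b \<in> B then b else 0"] by blast
  let ?K = "{k. axis k 1 \<in> B' - B}"
  have id: "g x = x" if "x \<in> M" for x
    by (rule vec.linear_eq_on_span[of g "\<lambda>x. x" B])
      (use g B' B that vec.linear_ident in auto)
  have "range g = g ` vec.span B'" using span by simp
  also have "\<dots> = vec.span (g ` B')" by (rule vec.linear_span_image[OF g(1), symmetric])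
  also have "\<dots> \<subseteq> M"
    using g(2) B(1) M by (intro vec.span_minimal) (auto simp: vec.subspace_0)
  finally have "range g \<subseteq> M" .
  moreover have "M \<subseteq> range g" using id by (metis rangeI subsetI)
  ultimately have "range g = M" by blast
  moreover have "B' \<subseteq> M \<union> (\<lambda>k. axis k 1) ` ?K"
    using B'(2) B(1) by (auto simp: cart_basis_def)
  then have "vec.span (M \<union> (\<lambda>k. axis k 1) ` ?K) = UNIV"
    using vec.span_mono span by blast
  ultimately show ?thesis
    using g id by (intro exI[of _ "matrix g"] exI[of _ ?K]) (auto simp: matrix_works)
qed

text \<open>A unique solution is fixed by every homomorphism over \<open>S\<close>; hence so is its projector along a
  coordinate subspace.\<close>

lemma unique_solution_rational:
  fixes C :: "((complex ^ 'n ^ 'n) \<times> nat) set" and S :: "complex set"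
  assumes S: "ring_hom_on S (\<lambda>x. x)" and inv: "\<And>x. x \<in> S \<Longrightarrow> inverse x \<in> S" and "countable S"
    and C: "finite C" "\<And>P l i j. (P, l) \<in> C \<Longrightarrow> P $ i $ j \<in> S"
    and sol: "solutions C r = {M}"
  shows "\<exists>Q :: complex ^ 'n ^ 'n. (\<forall>i j. Q $ i $ j \<in> S) \<and> rng Q = M"
proof -
  have M: "vec.subspace M" "vec.dim M = r" "\<And>P l. (P, l) \<in> C \<Longrightarrow> l \<le> vec.dim (M \<inter> rng P)"
    using sol by (auto simp: solutions_def)
  obtain Q :: "complex ^ 'n ^ 'n" and K where Q: "rng Q = M" "\<forall>x\<in>M. Q *v x = x"
    "\<forall>k\<in>K. Q *v axis k 1 = 0" "vec.span (M \<union> (\<lambda>k. axis k 1) ` K) = UNIV"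
    using ex_projector[OF M(1)] by metis
  have "Q ** Q *v x = Q *v x" for x
    using Q(1,2) by (metis matrix_vector_mul_assoc rangeI)
  then have idem: "Q ** Q = Q" by (simp add: matrix_eq)
  have "\<forall>c\<in>C. \<exists>B. finite B \<and> (\<forall>T (\<sigma> :: complex \<Rightarrow> complex). ring_hom_on T \<sigma> \<longrightarrow> B \<subseteq> T \<longrightarrow>
      snd c \<le> vec.dim (rng (map_matrix \<sigma> Q) \<inter> rng (map_matrix \<sigma> (fst c))))"
    using M(3) Q(1) by (intro ballI dim_rng_Int_certificate) auto
  then obtain B where B: "\<And>c. c \<in> C \<Longrightarrow> finite (B c)"
    "\<And>c T \<sigma>. c \<in> C \<Longrightarrow> ring_hom_on T \<sigma> \<Longrightarrow> B c \<subseteq> T \<Longrightarrow>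
      snd c \<le> vec.dim (rng (map_matrix \<sigma> Q) \<inter> rng (map_matrix (\<sigma> :: complex \<Rightarrow> complex) (fst c)))"
    by metis
  obtain B1 where B1: "finite B1" "\<And>T (\<sigma> :: complex \<Rightarrow> complex). ring_hom_on T \<sigma> \<Longrightarrow> B1 \<subseteq> T \<Longrightarrow>
      r \<le> vec.dim (rng (map_matrix \<sigma> Q))"
    using dim_rng_Int_certificate[of r Q Q, where ?'b = complex] M(2) Q(1) by auto
  obtain B2 where B2: "finite B2" "\<And>T (\<sigma> :: complex \<Rightarrow> complex). ring_hom_on T \<sigma> \<Longrightarrow> B2 \<subseteq> T \<Longrightarrow>
      vec.dim (rng (map_matrix \<sigma> Q)) \<le> r"
    using dim_rng_le_certificate[of Q, where ?'b = complex] M(2) Q(1) by auto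
  \<comment> \<open>A homomorphism that is defined on these numbers and is the identity on
    \<open>S\<close> turns \<open>Q\<close> into a matrix whose column space is again a
    solution.\<close>
  let ?B = "(\<Union>c\<in>C. B c) \<union> B1 \<union> B2 \<union> entries Q"
  have fin: "finite ?B" using B(1) C(1) B1 B2 by simp
  have "Q $ i $ j \<in> S" for i j
  proof (rule ccontr)
    assume "Q $ i $ j \<notin> S"
    from ex_hom_moving[OF S inv assms(3) this fin]
    obtain T \<tau> where T: "ring_hom_on T \<tau>" "?B \<union> insert (Q $ i $ j) S \<subseteq> T" "\<forall>x\<in>S. \<tau> x = x"
      "\<tau> (Q $ i $ j) \<noteq> Q $ i $ j"
      by blast
    interpret ring_hom_on T \<tau> by (rule T(1))
    let ?Q = "map_matrix \<tau> Q"
    have QT: "Q $ i $ j \<in> T" for i j using T(2) by (auto simp: entries_subset_iff)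
    have "l \<le> vec.dim (rng ?Q \<inter> rng P)" if "(P, l) \<in> C" for P l
    proof -
      have "map_matrix \<tau> P = P" using T(3) C(2)[OF that] by (simp add: vec_eq_iff)
      moreover have "B (P, l) \<subseteq> T" using T(2) that by blast
      ultimately show ?thesis using B(2)[OF that T(1)] by simp
    qed
    moreover have "vec.dim (rng ?Q) = r"
      using B1(2)[OF T(1)] B2(2)[OF T(1)] T(2) by simp
    ultimately have "rng ?Q \<in> solutions C r"
      unfolding solutions_def using subspace_rng by blast
    then have rng: "rng ?Q = M" using sol by simp
    have "?Q ** ?Q = ?Q" using map_matrix_mult[OF QT QT] idem by simp
    then have id: "?Q *v x = x" if "x \<in> M" for x
      using that rng by (metis (no_types, lifting) imageE matrix_vector_mul_assoc)
    have ker: "?Q *v axis k 1 = 0" if "k \<in> K" for k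
    proof -
      have "column k Q = 0" using Q(3) that by (simp add: mult_axis)
      then have "column k ?Q = 0" by (simp add: vec_eq_iff column_def hom_zero)
      then show ?thesis by (simp add: mult_axis)
    qed
    \<comment> \<open>Both matrices are the identity on \<open>M\<close> and vanish on the chosen
      coordinate vectors, hence are the same projector.\<close>
    have "?Q *v x = Q *v x" for x
      by (rule vec.linear_eq_on_span[of _ _ "M \<union> (\<lambda>k. axis k 1) ` K"])
        (use Q id ker in auto)
    then have "?Q = Q" by (simp add: matrix_eq)
    then have "\<tau> (Q $ i $ j) = Q $ i $ j" by (metis nth_map_matrix)
    then show False using T(4) by simp
  qed
  then show ?thesis using Q(1) by blast
qed

text \<open>The image of \<open>\<iota>\<close> is a countable subfield of \<complex>, so the unique
  solution has a matrix with entries in it. Pulled back along \<open>\<iota>\<close>, this matrix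
  spans a solution over \<open>'a\<close>.\<close>

lemma solutions_descend_countable:
  fixes C :: "(('a::field ^ 'n ^ 'n) \<times> nat) set" and \<iota> :: "'a \<Rightarrow> complex"
  assumes hom: "ring_hom_on UNIV \<iota>" and "countable (UNIV :: 'a set)" and "finite C"
    and sol: "card (solutions ((\<lambda>(P, l). (map_matrix \<iota> P, l)) ` C) r) = 1"
  shows "solutions C r \<noteq> {}"
proof -
  interpret ring_hom_on UNIV \<iota> by fact
  obtain M where M: "solutions ((\<lambda>(P, l). (map_matrix \<iota> P, l)) ` C) r = {M}"
    using sol by (auto simp: card_1_singleton_iff)
  have "ring_hom_on (range \<iota>) (\<lambda>x. x)"
  proof
    show "1 \<in> range \<iota>" by (metis hom_one rangeI)
    fix x assume "x \<in> range \<iota>"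
    then show "- x \<in> range \<iota>" by (metis hom_uminus UNIV_I imageE rangeI)
  next
    fix x y assume "x \<in> range \<iota>" "y \<in> range \<iota>"
    then obtain a b where "x = \<iota> a" "y = \<iota> b" by blast
    then show "x + y \<in> range \<iota>" "x * y \<in> range \<iota>"
      by (metis hom_add UNIV_I rangeI, metis hom_mult UNIV_I rangeI \<open>x = \<iota> a\<close> \<open>y = \<iota> b\<close>)
  qed auto
  moreover have "inverse x \<in> range \<iota>" if x: "x \<in> range \<iota>" for x
  proof -
    obtain a where a: "x = \<iota> a" using x by blast
    show ?thesis
    proof (cases "a = 0")
      case True
      then show ?thesis using a x hom_zero by simp
    next
      case False
      then have "\<iota> a * \<iota> (inverse a) = 1" using hom_mult[of a "inverse a"] hom_one by simp
      then have "inverse x = \<iota> (inverse a)" unfolding a by (rule inverse_unique)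
      then show ?thesis by simp
    qed
  qed
  moreover have "countable (range \<iota>)" using assms(2) by simp
  ultimately obtain Q :: "complex ^ 'n ^ 'n" where Q: "\<And>i j. Q $ i $ j \<in> range \<iota>" "rng Q = M"
    using unique_solution_rational[of "range \<iota>", OF _ _ _ _ _ M] assms(3) by fastforce
  have "\<forall>i j. \<exists>a. Q $ i $ j = \<iota> a" using Q(1) by blast
  then obtain R where R: "\<And>i j. Q $ i $ j = \<iota> (R i j)" by metis
  have "Q = map_matrix \<iota> (\<chi> i j. R i j)" using R by (simp add: vec_eq_iff)
  then have "rng (map_matrix \<iota> (\<chi> i j. R i j)) \<in> solutions ((\<lambda>(P, l). (map_matrix \<iota> P, l)) ` C) r"
    using Q(2) M by simp
  from solutions_descend[OF hom this] show ?thesis by blast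
qed

section \<open>Places of rational function fields\<close>

text \<open>There is a variable for each natural number, so that every position in the three bases
  can be encoded by \<open>to_nat\<close>, whatever \<open>'n\<close> is.\<close>

type_synonym 'a mpoly = "(nat \<Rightarrow>\<^sub>0 nat) \<Rightarrow>\<^sub>0 'a"

definition Var :: "nat \<Rightarrow> 'a::comm_ring_1 mpoly" where
  "Var i = Poly_Mapping.single (Poly_Mapping.single i 1) 1"

lemma poly_mapping_add_single_induct:
  assumes "P 0" and "\<And>m c u. P u \<Longrightarrow> P (Poly_Mapping.single m c + u)"
  shows "P (u :: 'a \<Rightarrow>\<^sub>0 'b::monoid_add)"
proof (induction u rule: update_induct)
  case const
  then show ?case by (rule assms(1))
next
  case (update f a b)
  have "Poly_Mapping.update a b f = Poly_Mapping.single a b + f"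
    using update(1)
    by (intro poly_mapping_eqI) (auto simp: lookup_update lookup_add lookup_single when_def in_keys_iff)
  then show ?case using assms(2)[OF update(3)] by simp
qed

lemma poly_mapping_eq_sum: "u = (\<Sum>m\<in>Poly_Mapping.keys u. Poly_Mapping.single m (Poly_Mapping.lookup u m))"
  by (rule poly_mapping_eqI) (auto simp: lookup_sum lookup_single when_def in_keys_iff)

locale comm_ring_hom =
  fixes h :: "'a::comm_ring_1 \<Rightarrow> 'b::comm_ring_1"
  assumes hom_one: "h 1 = 1"
    and hom_add: "h (x + y) = h x + h y"
    and hom_mult: "h (x * y) = h x * h y"
begin

lemma hom_zero: "h 0 = 0"
  using hom_add[of 0 0] by (metis add_cancel_right_right add_0)

lemma hom_power: "h (x ^ n) = h x ^ n"
  by (induction n) (simp_all add: hom_one hom_mult)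

lemma hom_prod: "h (prod f A) = (\<Prod>i\<in>A. h (f i))"
  by (induction A rule: infinite_finite_induct) (simp_all add: hom_one hom_mult)

end

lemma comm_ring_hom_comp: "comm_ring_hom g \<Longrightarrow> comm_ring_hom h \<Longrightarrow> comm_ring_hom (g \<circ> h)"
  by (simp add: comm_ring_hom_def)

lemma comm_ring_hom_of_int: "comm_ring_hom of_int"
  by unfold_locales auto

lemma comm_ring_hom_single: "comm_ring_hom (\<lambda>c :: 'a::comm_ring_1. Poly_Mapping.single (0 :: nat \<Rightarrow>\<^sub>0 nat) c)"
  by unfold_locales (auto simp: single_add mult_single)

definition eval_monom :: "(nat \<Rightarrow> 'b) \<Rightarrow> (nat \<Rightarrow>\<^sub>0 nat) \<Rightarrow> 'b::comm_ring_1" where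
  "eval_monom s m = (\<Prod>i\<in>Poly_Mapping.keys m. s i ^ Poly_Mapping.lookup m i)"

lemma eval_monom_superset:
  assumes "finite A" "Poly_Mapping.keys m \<subseteq> A"
  shows "eval_monom s m = (\<Prod>i\<in>A. s i ^ Poly_Mapping.lookup m i)"
  unfolding eval_monom_def using assms
  by (intro prod.mono_neutral_left) (auto simp: in_keys_iff)

lemma eval_monom_add: "eval_monom s (m + m') = eval_monom s m * eval_monom s m'"
proof -
  let ?A = "Poly_Mapping.keys m \<union> Poly_Mapping.keys m'"
  have "eval_monom s (m + m') = (\<Prod>i\<in>?A. s i ^ Poly_Mapping.lookup (m + m') i)"
    using keys_add[of m m'] by (intro eval_monom_superset) auto
  also have "\<dots> = (\<Prod>i\<in>?A. s i ^ Poly_Mapping.lookup m i) * (\<Prod>i\<in>?A. s i ^ Poly_Mapping.lookup m' i)"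
    by (simp add: lookup_add power_add prod.distrib)
  also have "\<dots> = eval_monom s m * eval_monom s m'"
    by (simp add: eval_monom_superset[of ?A])
  finally show ?thesis .
qed

lemma eval_monom_0: "eval_monom s 0 = 1"
  by (simp add: eval_monom_def)

lemma eval_monom_single: "eval_monom s (Poly_Mapping.single i k) = s i ^ k"
  by (cases "k = 0") (simp_all add: eval_monom_def)

lemma eval_monom_Var: "eval_monom Var m = (Poly_Mapping.single m 1 :: 'a::comm_ring_1 mpoly)"
proof (induction m rule: poly_mapping_add_single_induct)
  case 1
  then show ?case by (simp add: eval_monom_0)
next
  case (2 i k m)
  have "Var i ^ k = (Poly_Mapping.single (Poly_Mapping.single i k) 1 :: 'a mpoly)"
    by (induction k) (simp_all add: Var_def mult_single single_add[symmetric])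
  then show ?case using 2 by (simp add: eval_monom_add eval_monom_single mult_single)
qed

text \<open>The separate map \<open>c\<close> on coefficients lets one function cover evaluation at
  complex points, change of the coefficient ring and substitution of polynomials.\<close>

definition eval_poly :: "('a \<Rightarrow> 'b) \<Rightarrow> (nat \<Rightarrow> 'b) \<Rightarrow> 'a::comm_ring_1 mpoly \<Rightarrow> 'b::comm_ring_1" where
  "eval_poly c s u = (\<Sum>m\<in>Poly_Mapping.keys u. c (Poly_Mapping.lookup u m) * eval_monom s m)"

context comm_ring_hom
begin

lemma hom_eval_monom: "h (eval_monom s m) = eval_monom (\<lambda>i. h (s i)) m"
  by (simp add: eval_monom_def hom_prod hom_power)

lemma eval_poly_superset:
  assumes "finite A" "Poly_Mapping.keys u \<subseteq> A"
  shows "eval_poly h s u = (\<Sum>m\<in>A. h (Poly_Mapping.lookup u m) * eval_monom s m)"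
  unfolding eval_poly_def using assms
  by (intro sum.mono_neutral_left) (auto simp: in_keys_iff hom_zero)

lemma eval_poly_0: "eval_poly h s 0 = 0"
  by (simp add: eval_poly_def)

lemma eval_poly_single: "eval_poly h s (Poly_Mapping.single m c) = h c * eval_monom s m"
  by (subst eval_poly_superset[of "{m}"]) (auto simp: keys_single)

lemma eval_poly_add: "eval_poly h s (u + w) = eval_poly h s u + eval_poly h s w"
proof -
  let ?A = "Poly_Mapping.keys u \<union> Poly_Mapping.keys w"
  have "eval_poly h s (u + w) = (\<Sum>m\<in>?A. h (Poly_Mapping.lookup (u + w) m) * eval_monom s m)"
    using keys_add[of u w] by (intro eval_poly_superset) auto
  then show ?thesis
    by (simp add: lookup_add hom_add distrib_right sum.distrib eval_poly_superset[of ?A])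
qed

lemma eval_poly_single_mult:
  "eval_poly h s (Poly_Mapping.single m c * w) = h c * eval_monom s m * eval_poly h s w"
  by (induction w rule: poly_mapping_add_single_induct)
    (simp_all add: eval_poly_0 distrib_left eval_poly_add mult_single eval_poly_single hom_mult
      eval_monom_add mult_ac)

lemma eval_poly_mult: "eval_poly h s (u * w) = eval_poly h s u * eval_poly h s w"
  by (induction u rule: poly_mapping_add_single_induct)
    (simp_all add: eval_poly_0 distrib_right eval_poly_add eval_poly_single eval_poly_single_mult)

lemma eval_poly_Var: "eval_poly h s (Var i) = s i"
  by (simp add: Var_def eval_poly_single hom_one eval_monom_single)

lemma comm_ring_hom_eval_poly: "comm_ring_hom (eval_poly h s)"
proof
  show "eval_poly h s 1 = 1"
    using eval_poly_single[of s 0 1] by (simp add: hom_one eval_monom_0)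
qed (simp_all add: eval_poly_add eval_poly_mult)

end

section \<open>Places and embeddings of fraction fields\<close>

lemma ex_place_fract:
  fixes h :: "'r::idom \<Rightarrow> 'b::field"
  assumes "comm_ring_hom h"
    and frac: "\<And>u w. w \<noteq> 0 \<Longrightarrow> \<exists>u' w'. u * w' = u' * w \<and> (h u' \<noteq> 0 \<or> h w' \<noteq> 0)"
  shows "\<exists>O\<^sub>v \<pi>. place O\<^sub>v \<pi> \<and> (\<forall>u w. h w \<noteq> 0 \<longrightarrow> Fract u w \<in> O\<^sub>v) \<and> (\<forall>u. \<pi> (Fract u 1) = h u)"
proof -
  interpret comm_ring_hom h by fact
  let ?R = "range (\<lambda>u. Fract u 1)"
  define g where "g x = h (SOME u. x = Fract u 1)" for x
  have g: "g (Fract u 1) = h u" for u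
    unfolding g_def by (rule someI2[of _ u]) (auto simp: eq_fract)
  have R: "ring_hom_on ?R g"
  proof
    show "1 \<in> ?R" by (auto simp: One_fract_def)
    show "g 1 = 1" using g[of 1] by (simp add: One_fract_def[symmetric] hom_one)
  qed (auto simp: g hom_add hom_mult)
  have "\<exists>u\<in>?R. \<exists>w\<in>?R. x * w = u \<and> (g u \<noteq> 0 \<or> g w \<noteq> 0)" for x
  proof (cases x)
    case (Fract u w)
    then obtain u' w' where "u * w' = u' * w" "h u' \<noteq> 0 \<or> h w' \<noteq> 0" using frac by blast
    then have "x * Fract w' 1 = Fract u' 1" "g (Fract u' 1) \<noteq> 0 \<or> g (Fract w' 1) \<noteq> 0"
      using Fract by (simp_all add: eq_fract g)
    then show ?thesis by blast
  qed
  from ex_place_extending_hom[OF R this] obtain \<pi>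
    where \<pi>: "place {x. \<exists>u\<in>?R. \<exists>w\<in>?R. x * w = u \<and> g w \<noteq> 0} \<pi>" "\<forall>x\<in>?R. \<pi> x = g x" by blast
  have "Fract u w \<in> {x. \<exists>u\<in>?R. \<exists>w\<in>?R. x * w = u \<and> g w \<noteq> 0}" if w: "h w \<noteq> 0" for u w
  proof -
    have "w \<noteq> 0" using w hom_zero by auto
    then have "Fract u w * Fract w 1 = Fract u 1" by (simp add: eq_fract)
    moreover have "g (Fract w 1) \<noteq> 0" using w g by simp
    ultimately show ?thesis by blast
  qed
  then show ?thesis using \<pi> g
    by (intro exI[of _ "{x. \<exists>u\<in>?R. \<exists>w\<in>?R. x * w = u \<and> g w \<noteq> 0}"] exI[of _ \<pi>]) auto
qed

text \<open>A place whose valuation ring is the whole field is an embedding.\<close>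

lemma ex_fract_embedding:
  fixes h :: "'r::idom \<Rightarrow> 'b::field"
  assumes h: "comm_ring_hom h" and inj: "\<And>u. u \<noteq> 0 \<Longrightarrow> h u \<noteq> 0"
  shows "\<exists>\<iota>. ring_hom_on UNIV \<iota> \<and> (\<forall>u. \<iota> (Fract u 1) = h u)"
proof -
  have "\<exists>u' w'. u * w' = u' * w \<and> (h u' \<noteq> 0 \<or> h w' \<noteq> 0)" if "w \<noteq> 0" for u w
    using inj[OF that] by blast
  from ex_place_fract[OF h this] obtain O\<^sub>v \<iota> where \<iota>: "place O\<^sub>v \<iota>"
    "\<forall>u w. h w \<noteq> 0 \<longrightarrow> Fract u w \<in> O\<^sub>v" "\<forall>u. \<iota> (Fract u 1) = h u" by blast
  have "x \<in> O\<^sub>v" for x using \<iota>(2) inj by (cases x) auto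
  then have "O\<^sub>v = UNIV" by blast
  then show ?thesis using \<iota>(1,3) by (auto simp: place_def)
qed

text \<open>Strict monotonicity of addition leaves \<open>(d, e)\<close> as the only pair of
  exponents with sum \<open>d + e\<close>. The bounds need not be attained; otherwise both sides are
  0.\<close>

lemma lookup_mult_lowest:
  fixes u w :: "'k::{ordered_cancel_comm_monoid_add, linorder} \<Rightarrow>\<^sub>0 'a::comm_ring_1"
  assumes "\<forall>m\<in>Poly_Mapping.keys u. d \<le> m" and "\<forall>m\<in>Poly_Mapping.keys w. e \<le> m"
  shows "Poly_Mapping.lookup (u * w) (d + e) = Poly_Mapping.lookup u d * Poly_Mapping.lookup w e"
proof -
  let ?lu = "Poly_Mapping.lookup u" and ?lw = "Poly_Mapping.lookup w"
  have eq: "a + b = d + e \<longleftrightarrow> a = d \<and> b = e" if "d \<le> a" "e \<le> b" for a b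
    using that by (metis add_less_le_mono add_left_imp_eq le_less less_irrefl)
  have "u * w = (\<Sum>a\<in>Poly_Mapping.keys u. Poly_Mapping.single a (?lu a)) *
      (\<Sum>b\<in>Poly_Mapping.keys w. Poly_Mapping.single b (?lw b))"
    by (simp flip: poly_mapping_eq_sum)
  also have "\<dots> = (\<Sum>a\<in>Poly_Mapping.keys u. \<Sum>b\<in>Poly_Mapping.keys w.
      Poly_Mapping.single (a + b) (?lu a * ?lw b))"
    by (simp add: sum_product mult_single)
  finally have "Poly_Mapping.lookup (u * w) (d + e) =
      (\<Sum>a\<in>Poly_Mapping.keys u. \<Sum>b\<in>Poly_Mapping.keys w. (?lu a * ?lw b when a + b = d + e))"
    by (simp add: lookup_sum lookup_single)
  also have "\<dots> = (\<Sum>a\<in>Poly_Mapping.keys u. \<Sum>b\<in>Poly_Mapping.keys w.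
      (if a = d then ?lu a else 0) * (if b = e then ?lw b else 0))"
    using assms by (intro sum.cong refl) (auto simp: when_def eq)
  also have "\<dots> = (\<Sum>a\<in>Poly_Mapping.keys u. if a = d then ?lu a else 0) *
      (\<Sum>b\<in>Poly_Mapping.keys w. if b = e then ?lw b else 0)"
    by (simp only: sum_product)
  also have "\<dots> = ?lu d * ?lw e"
    by (simp add: in_keys_iff)
  finally show ?thesis .
qed

text \<open>The valuation of a polynomial is its lexicographically lowest exponent; the residue is the
  coefficient there.\<close>

lemma ex_place_lowest_term:
  "\<exists>O\<^sub>v (\<pi> :: 'a::field mpoly fract \<Rightarrow> 'a). place O\<^sub>v \<pi> \<and>
     (\<forall>u. (\<forall>m\<in>Poly_Mapping.keys u. 0 \<le> m) \<longrightarrow>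
        Fract u 1 \<in> O\<^sub>v \<and> \<pi> (Fract u 1) = Poly_Mapping.lookup u 0)"
proof -
  let ?X = "\<lambda>d :: nat \<Rightarrow>\<^sub>0 nat. Poly_Mapping.single d (1 :: 'a)"
  let ?low = "\<lambda>(u :: 'a mpoly) d. \<forall>m\<in>Poly_Mapping.keys u. d \<le> m"
  \<comment> \<open>The order is lexicographic, not componentwise, so the monomial need not divide
    \<open>u\<close>. This is the ring of Laurent polynomials with nonnegative exponents in that
    order, and \<open>h\<close> below takes the constant coefficient.\<close>
  let ?R = "{Fract u (?X d) |u d. ?low u d}"
  have X: "?X d \<noteq> 0" for d by (metis lookup_single_eq lookup_zero zero_neq_one)
  have XX: "?X d * ?X e = ?X (d + e)" for d e by (simp add: mult_single)
  have lowX: "?low (?X d) d" for d by simp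
  have low_mult: "?low (u * w) (d + e)" if "?low u d" "?low w e" for u w d e
    using that keys_mult[of u w] by (auto intro!: add_mono)
  define h where "h x = (THE c. \<exists>u d. x = Fract u (?X d) \<and> ?low u d \<and> c = Poly_Mapping.lookup u d)"
    for x
  have h: "h (Fract u (?X d)) = Poly_Mapping.lookup u d" if u: "?low u d" for u d
    unfolding h_def
  proof (rule the_equality)
    fix c assume "\<exists>u' d'. Fract u (?X d) = Fract u' (?X d') \<and> ?low u' d' \<and> c = Poly_Mapping.lookup u' d'"
    then obtain u' d' where u': "Fract u (?X d) = Fract u' (?X d')" "?low u' d'"
      "c = Poly_Mapping.lookup u' d'" by blast
    have "u * ?X d' = u' * ?X d" using u'(1) X by (simp add: eq_fract)
    then have "Poly_Mapping.lookup (u * ?X d') (d + d') = Poly_Mapping.lookup (u' * ?X d) (d' + d)"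
      by (simp add: add.commute)
    then show "c = Poly_Mapping.lookup u d"
      using lookup_mult_lowest[OF u lowX] lookup_mult_lowest[OF u'(2) lowX] u'(3) by simp
  qed (use u in blast)
  have R: "ring_hom_on ?R h"
  proof
    have "(1 :: 'a mpoly fract) = Fract 1 (?X 0)" by (simp add: One_fract_def)
    moreover have l1: "?low 1 0" by simp
    ultimately show "1 \<in> ?R" by blast
    show "h 1 = 1" using h[OF l1] by (simp add: One_fract_def[symmetric])
  next
    fix x y assume "x \<in> ?R" "y \<in> ?R"
    then obtain u d w e where xy: "x = Fract u (?X d)" "?low u d" "y = Fract w (?X e)" "?low w e"
      by blast
    have a: "x + y = Fract (u * ?X e + w * ?X d) (?X (d + e))"
      using X xy(1,3) by (simp add: XX)
    have la: "?low (u * ?X e + w * ?X d) (d + e)"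
    proof -
      have "?low (u * ?X e) (d + e)" by (rule low_mult[OF xy(2) lowX])
      moreover have "?low (w * ?X d) (d + e)"
        using low_mult[OF xy(4) lowX, of d] by (simp add: add.commute)
      ultimately show ?thesis using keys_add[of "u * ?X e" "w * ?X d"] by blast
    qed
    show "x + y \<in> ?R" using a la by blast
    show "h (x + y) = h x + h y"
      unfolding a h[OF la] using lookup_mult_lowest[OF xy(2) lowX, of e]
        lookup_mult_lowest[OF xy(4) lowX, of d]
      by (simp add: lookup_add xy(1,3) h[OF xy(2)] h[OF xy(4)] add.commute[of e d])
    have m: "x * y = Fract (u * w) (?X (d + e))" using xy by (simp add: XX)
    have lm: "?low (u * w) (d + e)" by (rule low_mult[OF xy(2,4)])
    show "x * y \<in> ?R" using m lm by blast
    show "h (x * y) = h x * h y"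
      unfolding m h[OF lm] using lookup_mult_lowest[OF xy(2,4)]
      by (simp add: xy(1,3) h[OF xy(2)] h[OF xy(4)])
  next
    fix x assume "x \<in> ?R"
    then obtain u d where x: "x = Fract u (?X d)" "?low u d" by blast
    then have "- x = Fract (- u) (?X d)" "?low (- u) d" by (auto simp: in_keys_iff)
    then show "- x \<in> ?R" by blast
  qed
  have "\<exists>u\<in>?R. \<exists>w\<in>?R. x * w = u \<and> (h u \<noteq> 0 \<or> h w \<noteq> 0)" for x
  proof (cases x)
    case (Fract u w)
    \<comment> \<open>Dividing numerator and denominator by the least monomial that occurs in either
      gives at least one of them a nonzero constant coefficient.\<close>
    let ?d = "Min (Poly_Mapping.keys u \<union> Poly_Mapping.keys w)"
    have ne: "Poly_Mapping.keys u \<union> Poly_Mapping.keys w \<noteq> {}" using Fract(2) by simp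
    have l: "?low u ?d" "?low w ?d" by (auto intro!: Min_le)
    have "?d \<in> Poly_Mapping.keys u \<union> Poly_Mapping.keys w" using ne by (intro Min_in) auto
    then have "h (Fract u (?X ?d)) \<noteq> 0 \<or> h (Fract w (?X ?d)) \<noteq> 0"
      using h[OF l(1)] h[OF l(2)] by (auto simp: in_keys_iff)
    moreover have "x * Fract w (?X ?d) = Fract u (?X ?d)"
      using Fract X by (simp add: eq_fract)
    ultimately show ?thesis using l by blast
  qed
  from ex_place_extending_hom[OF R this] obtain \<pi>
    where \<pi>: "place {x. \<exists>u\<in>?R. \<exists>w\<in>?R. x * w = u \<and> h w \<noteq> 0} \<pi>" "\<forall>x\<in>?R. \<pi> x = h x" by blast
  interpret place "{x. \<exists>u\<in>?R. \<exists>w\<in>?R. x * w = u \<and> h w \<noteq> 0}" \<pi> by (rule \<pi>(1))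
  interpret R: ring_hom_on ?R h by (rule R)
  have "Fract u 1 \<in> {x. \<exists>u\<in>?R. \<exists>w\<in>?R. x * w = u \<and> h w \<noteq> 0} \<and> \<pi> (Fract u 1) = Poly_Mapping.lookup u 0"
    if u: "?low u 0" for u
  proof -
    have "Fract u 1 = Fract u (?X 0)" by simp
    then have uR: "Fract u 1 \<in> ?R" using u by blast
    moreover have "Fract u 1 * 1 = Fract u 1" "h 1 \<noteq> 0" using R.hom_one by simp_all
    ultimately have "Fract u 1 \<in> {x. \<exists>u\<in>?R. \<exists>w\<in>?R. x * w = u \<and> h w \<noteq> 0}"
      using R.one_mem by blast
    moreover have "\<pi> (Fract u 1) = Poly_Mapping.lookup u 0"
      using \<pi>(2) uR h[OF u] by simp
    ultimately show ?thesis by blast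
  qed
  then show ?thesis using \<pi>(1) by blast
qed

section \<open>Translation of a point to the origin and reduction of integer coefficients\<close>

abbreviation Const :: "'a::comm_ring_1 \<Rightarrow> 'a mpoly" where
  "Const c \<equiv> Poly_Mapping.single 0 c"

text \<open>The substitution moves the point \<open>a\<close> to the origin, where the value of a
  polynomial is its coefficient at exponent 0.\<close>

definition translate :: "(nat \<Rightarrow> 'a) \<Rightarrow> 'a::comm_ring_1 mpoly \<Rightarrow> 'a mpoly" where
  "translate a = eval_poly Const (\<lambda>i. Var i + Const (a i))"

lemma comm_ring_hom_translate: "comm_ring_hom (translate a)"
  unfolding translate_def by (rule comm_ring_hom.comm_ring_hom_eval_poly[OF comm_ring_hom_single])

text \<open>Invertibility gives injectivity: a polynomial that survives the reduction of
  coefficients also survives the translation.\<close>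

lemma translate_translate_uminus: "translate (\<lambda>i. - a i) (translate a u) = u"
proof -
  interpret C: comm_ring_hom Const by (rule comm_ring_hom_single)
  interpret T: comm_ring_hom "translate (\<lambda>i. - a i)" by (rule comm_ring_hom_translate)
  interpret T': comm_ring_hom "translate a" by (rule comm_ring_hom_translate)
  have Const: "translate (\<lambda>i. - a i) (Const c) = Const c" for c
    by (simp add: translate_def C.eval_poly_single eval_monom_0)
  have "translate (\<lambda>i. - a i) (Var i + Const (a i)) = Var i" for i
  proof -
    have "translate (\<lambda>i. - a i) (Var i) = Var i + Const (- a i)"
      by (simp add: translate_def C.eval_poly_Var)
    then show ?thesis by (simp add: T.hom_add Const single_uminus)
  qed
  then have single: "translate (\<lambda>i. - a i) (translate a (Poly_Mapping.single m c)) = Poly_Mapping.single m c"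
    for m c
    unfolding translate_def[of a] C.eval_poly_single T.hom_mult T.hom_eval_monom Const
    by (simp add: eval_monom_Var mult_single)
  show ?thesis
    by (induction u rule: poly_mapping_add_single_induct)
      (simp_all add: T.hom_zero T'.hom_zero T.hom_add T'.hom_add single)
qed

lemma lookup_eval_poly_Const_Var:
  fixes c :: "'a::comm_ring_1 \<Rightarrow> 'b::comm_ring_1"
  assumes "comm_ring_hom c"
  shows "Poly_Mapping.lookup (eval_poly (\<lambda>z. Const (c z)) Var u) m = c (Poly_Mapping.lookup u m)"
proof -
  interpret c: comm_ring_hom c by fact
  interpret comm_ring_hom "\<lambda>z. Const (c z)"
    using comm_ring_hom_comp[OF comm_ring_hom_single assms] by (simp add: o_def)
  show ?thesis
    by (induction u rule: poly_mapping_add_single_induct)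
      (simp_all add: eval_poly_0 c.hom_zero eval_poly_add eval_poly_single lookup_add c.hom_add
        eval_monom_Var mult_single lookup_single when_def)
qed

lemma lookup_Const_mult: "Poly_Mapping.lookup (Const s * u) m = s * Poly_Mapping.lookup u m"
  by (simp add: mult_map_scale_conv_mult[symmetric] Poly_Mapping.map.rep_eq when_def)

text \<open>Divide by the characteristic until one of the two polynomials survives the reduction of the
  coefficients.\<close>

lemma ex_not_both_divisible:
  fixes u w :: "int mpoly"
  assumes "w \<noteq> 0"
  shows "\<exists>u' w'. u * w' = u' * w \<and>
    ((\<exists>m. of_int (Poly_Mapping.lookup u' m) \<noteq> (0 :: 'a::field)) \<or>
     (\<exists>m. of_int (Poly_Mapping.lookup w' m) \<noteq> (0 :: 'a)))"
proof -
  obtain m0 where "Poly_Mapping.lookup w m0 \<noteq> 0"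
    using assms by (metis lookup_zero poly_mapping_eqI)
  then show ?thesis
  proof (induction "nat \<bar>Poly_Mapping.lookup w m0\<bar>" arbitrary: u w rule: less_induct)
    case less
    show ?case
    proof (cases "(\<exists>m. of_int (Poly_Mapping.lookup u m) \<noteq> (0 :: 'a)) \<or>
        (\<exists>m. of_int (Poly_Mapping.lookup w m) \<noteq> (0 :: 'a))")
      case True
      then show ?thesis by blast
    next
      case False
      let ?p = "int CHAR('a)"
      have dvd: "?p dvd Poly_Mapping.lookup u m" "?p dvd Poly_Mapping.lookup w m" for m
        using False of_int_eq_0_iff_char_dvd[where ?'a = 'a] by blast+
      have quot: "\<exists>v'. v = Const ?p * v'" if v: "\<And>m. ?p dvd Poly_Mapping.lookup v m" for v :: "int mpoly"
      proof -
        have "v = Const ?p * Poly_Mapping.map (\<lambda>c. c div ?p) v"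
          using v by (intro poly_mapping_eqI)
            (simp add: lookup_Const_mult Poly_Mapping.map.rep_eq when_def del: single_of_nat)
        then show ?thesis by blast
      qed
      obtain u1 w1 where uw: "u = Const ?p * u1" "w = Const ?p * w1"
        using quot dvd by metis
      have lw: "Poly_Mapping.lookup w m0 = ?p * Poly_Mapping.lookup w1 m0"
        unfolding uw(2) by (rule lookup_Const_mult)
      \<comment> \<open>In characteristic 0 this case is impossible, as 0 divides only 0 and the
        coefficient at \<open>m0\<close> is nonzero. In positive characteristic the absolute value
        of that coefficient drops with each division, so the process stops.\<close>
      have "CHAR('a) \<noteq> 0" using less.prems lw by (intro notI) simp
      moreover have "CHAR('a) \<noteq> 1" using CHAR_not_1[where ?'a = 'a] by simp
      ultimately have p: "\<bar>?p\<bar> > 1" by linarith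
      have nz: "Poly_Mapping.lookup w1 m0 \<noteq> 0" using less.prems lw by auto
      have "\<bar>Poly_Mapping.lookup w1 m0\<bar> < \<bar>Poly_Mapping.lookup w m0\<bar>"
        using nz p unfolding lw abs_mult by simp
      then have "nat \<bar>Poly_Mapping.lookup w1 m0\<bar> < nat \<bar>Poly_Mapping.lookup w m0\<bar>" by simp
      from less.hyps[OF this nz] obtain u' w' where u': "u1 * w' = u' * w1"
        "(\<exists>m. of_int (Poly_Mapping.lookup u' m) \<noteq> (0 :: 'a)) \<or>
         (\<exists>m. of_int (Poly_Mapping.lookup w' m) \<noteq> (0 :: 'a))" by blast
      have "u * w' = Const ?p * (u1 * w')" unfolding uw by (simp add: mult.assoc)
      also have "\<dots> = u' * w" unfolding uw u'(1) by (simp add: mult_ac)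
      finally show ?thesis using u'(2) by blast
    qed
  qed
qed

lemma zero_le_single: "0 \<le> (Poly_Mapping.single i k :: nat \<Rightarrow>\<^sub>0 nat)"
proof (cases "k = 0")
  case False
  then have "0 < (Poly_Mapping.single i k :: nat \<Rightarrow>\<^sub>0 nat)"
    unfolding less_poly_mapping.rep_eq less_fun_def
    by (intro exI[of _ i]) (auto simp: lookup_single when_def)
  then show ?thesis by simp
qed simp

text \<open>Evaluation at \<open>a\<close> alone need not suffice: coprime polynomials may both
  vanish at \<open>a\<close>, and then no rewriting of their quotient helps. The first place
  therefore keeps the variables transcendental, so that only powers of the characteristic have to be
  cancelled; the second one reads off the value at \<open>a\<close> as a constant coefficient after
  translation.\<close>

lemma ex_place_generic:
  fixes a :: "nat \<Rightarrow> 'a::field"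
  shows "\<exists>O\<^sub>v (\<pi> :: int mpoly fract \<Rightarrow> 'a). place O\<^sub>v \<pi> \<and>
    (\<forall>i. Fract (Var i) 1 \<in> O\<^sub>v \<and> \<pi> (Fract (Var i) 1) = a i)"
proof -
  have of_int: "comm_ring_hom (of_int :: int \<Rightarrow> 'a)" by (rule comm_ring_hom_of_int)
  have C: "comm_ring_hom (\<lambda>z :: int. Const (of_int z :: 'a))"
    using comm_ring_hom_comp[OF comm_ring_hom_single of_int] unfolding o_def .
  define g :: "int mpoly \<Rightarrow> 'a mpoly" where "g = eval_poly (\<lambda>z. Const (of_int z)) Var"
  have g: "comm_ring_hom g"
    unfolding g_def by (rule comm_ring_hom.comm_ring_hom_eval_poly[OF C])
  have gX: "g (Var i) = Var i" for i
    unfolding g_def by (rule comm_ring_hom.eval_poly_Var[OF C])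
  have lookup_g: "Poly_Mapping.lookup (g u) m = of_int (Poly_Mapping.lookup u m)" for u m
    unfolding g_def by (rule lookup_eval_poly_Const_Var[OF of_int])
  define h where "h u = Fract (translate a (g u)) 1" for u
  have "comm_ring_hom (\<lambda>u :: 'a mpoly. Fract u 1)"
    by unfold_locales (auto simp: One_fract_def)
  then have h: "comm_ring_hom h"
    using comm_ring_hom_comp[OF _ comm_ring_hom_comp[OF comm_ring_hom_translate g]]
    unfolding h_def by (auto simp: o_def)
  have h0: "h u \<noteq> 0" if "\<exists>m. of_int (Poly_Mapping.lookup u m) \<noteq> (0 :: 'a)" for u
  proof
    assume "h u = 0"
    then have "translate a (g u) = 0" by (simp add: h_def Zero_fract_def eq_fract)
    then have "g u = translate (\<lambda>i. - a i) 0" by (metis translate_translate_uminus)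
    then have "g u = 0" using comm_ring_hom.hom_zero[OF comm_ring_hom_translate] by metis
    then show False using that lookup_g[of u] by simp
  qed
  have "\<exists>u' w'. u * w' = u' * w \<and> (h u' \<noteq> 0 \<or> h w' \<noteq> 0)" if "w \<noteq> 0" for u w
    using ex_not_both_divisible[OF that, of u, where ?'a = 'a] h0 by blast
  from ex_place_fract[OF h this] obtain O\<^sub>1 and \<pi>\<^sub>1 :: "int mpoly fract \<Rightarrow> 'a mpoly fract"
    where 1: "place O\<^sub>1 \<pi>\<^sub>1" "\<forall>u w. h w \<noteq> 0 \<longrightarrow> Fract u w \<in> O\<^sub>1" "\<forall>u. \<pi>\<^sub>1 (Fract u 1) = h u" by blast
  obtain O\<^sub>2 and \<pi>\<^sub>2 :: "'a mpoly fract \<Rightarrow> 'a" where 2: "place O\<^sub>2 \<pi>\<^sub>2"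
    "\<forall>u. (\<forall>m\<in>Poly_Mapping.keys u. 0 \<le> m) \<longrightarrow>
        Fract u 1 \<in> O\<^sub>2 \<and> \<pi>\<^sub>2 (Fract u 1) = Poly_Mapping.lookup u 0"
    using ex_place_lowest_term by blast
  have X: "Fract (Var i) 1 \<in> O\<^sub>1 \<and> \<pi>\<^sub>1 (Fract (Var i) 1) \<in> O\<^sub>2 \<and> \<pi>\<^sub>2 (\<pi>\<^sub>1 (Fract (Var i) 1)) = a i" for i
  proof -
    let ?u = "Var i + Const (a i) :: 'a mpoly"
    have "h 1 \<noteq> 0" using comm_ring_hom.hom_one[OF h] by simp
    then have "Fract (Var i) 1 \<in> O\<^sub>1" using 1(2) by blast
    moreover have "\<pi>\<^sub>1 (Fract (Var i) 1) = Fract ?u 1"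
      using 1(3) by (simp add: h_def gX translate_def comm_ring_hom.eval_poly_Var[OF comm_ring_hom_single])
    moreover have "\<forall>m\<in>Poly_Mapping.keys ?u. 0 \<le> m"
      using keys_add[of "Var i" "Const (a i)"] zero_le_single[of i 1]
      by (auto simp: Var_def split: if_splits)
    moreover have "Poly_Mapping.single i 1 \<noteq> (0 :: nat \<Rightarrow>\<^sub>0 nat)" for i :: nat
      by (metis lookup_single_eq lookup_zero zero_neq_one)
    then have "Poly_Mapping.lookup ?u 0 = a i"
      by (simp add: lookup_add Var_def lookup_single when_def)
    ultimately show ?thesis using 2(2) by metis
  qed
  show ?thesis
    using place_comp[OF 1(1) 2(1)] X
    by (intro exI[of _ "{x \<in> O\<^sub>1. \<pi>\<^sub>1 x \<in> O\<^sub>2}"] exI[of _ "\<pi>\<^sub>2 \<circ> \<pi>\<^sub>1"]) simp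
qed

section \<open>Generic points\<close>

text \<open>No polynomial expression is demanded: choosing the coordinates of a point one after
  another uses only these two properties, and both pass to sums and products.\<close>

definition polynomial_fun :: "((nat \<Rightarrow> complex) \<Rightarrow> complex) \<Rightarrow> bool" where
  "polynomial_fun f \<longleftrightarrow> (\<forall>i x. \<exists>q. \<forall>t. f (x(i := t)) = poly q t) \<and>
     (\<exists>N. \<forall>x y. (\<forall>i<N. x i = y i) \<longrightarrow> f x = f y)"

lemma polynomial_fun_const: "polynomial_fun (\<lambda>x. c)"
  unfolding polynomial_fun_def by (auto intro: exI[of _ "[:c:]"])

lemma polynomial_fun_coord: "polynomial_fun (\<lambda>x. x j)"
  unfolding polynomial_fun_def
proof (intro conjI allI)
  fix i and x :: "nat \<Rightarrow> complex"
  show "\<exists>q. \<forall>t. (x(i := t)) j = poly q t"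
    by (cases "i = j") (auto intro: exI[of _ "[:0, 1:]"] exI[of _ "[:x j:]"])
  show "\<exists>N. \<forall>x y :: nat \<Rightarrow> complex. (\<forall>i<N. x i = y i) \<longrightarrow> x j = y j"
    by (intro exI[of _ "Suc j"]) simp
qed

lemma polynomial_fun_op:
  assumes "polynomial_fun f" "polynomial_fun g"
    and "\<And>p q. \<exists>r. \<forall>t. op (poly p t) (poly q t) = poly r t"
  shows "polynomial_fun (\<lambda>x. op (f x) (g x))"
proof -
  obtain M where M: "\<And>x y. (\<forall>i<M. x i = y i) \<Longrightarrow> f x = f y"
    using assms(1) unfolding polynomial_fun_def by blast
  obtain N where N: "\<And>x y. (\<forall>i<N. x i = y i) \<Longrightarrow> g x = g y"
    using assms(2) unfolding polynomial_fun_def by blast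
  have "op (f x) (g x) = op (f y) (g y)" if "\<forall>i<max M N. x i = y i" for x y
    using M[of x y] N[of x y] that by auto
  moreover have "\<exists>r. \<forall>t. op (f (x(i := t))) (g (x(i := t))) = poly r t" for i x
  proof -
    obtain p where p: "\<And>t. f (x(i := t)) = poly p t"
      using assms(1) unfolding polynomial_fun_def by blast
    obtain q where q: "\<And>t. g (x(i := t)) = poly q t"
      using assms(2) unfolding polynomial_fun_def by blast
    show ?thesis unfolding p q by (rule assms(3))
  qed
  ultimately show ?thesis unfolding polynomial_fun_def by blast
qed

lemma polynomial_fun_add: "polynomial_fun f \<Longrightarrow> polynomial_fun g \<Longrightarrow> polynomial_fun (\<lambda>x. f x + g x)"
  by (rule polynomial_fun_op[where op = "(+)"]) (metis poly_add)+

lemma polynomial_fun_mult: "polynomial_fun f \<Longrightarrow> polynomial_fun g \<Longrightarrow> polynomial_fun (\<lambda>x. f x * g x)"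
  by (rule polynomial_fun_op[where op = "(*)"]) (metis poly_mult)+

lemma polynomial_fun_sum:
  "(\<And>i. i \<in> A \<Longrightarrow> polynomial_fun (f i)) \<Longrightarrow> polynomial_fun (\<lambda>x. \<Sum>i\<in>A. f i x)"
  by (induction A rule: infinite_finite_induct)
    (simp_all add: polynomial_fun_const polynomial_fun_add)

lemma polynomial_fun_prod:
  "(\<And>i. i \<in> A \<Longrightarrow> polynomial_fun (f i)) \<Longrightarrow> polynomial_fun (\<lambda>x. \<Prod>i\<in>A. f i x)"
  by (induction A rule: infinite_finite_induct)
    (simp_all add: polynomial_fun_const polynomial_fun_mult)

lemma polynomial_fun_power: "polynomial_fun f \<Longrightarrow> polynomial_fun (\<lambda>x. f x ^ n)"
  by (induction n) (simp_all add: polynomial_fun_const polynomial_fun_mult)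

lemma polynomial_fun_eval_poly: "polynomial_fun (\<lambda>x. eval_poly of_int x u)"
  unfolding eval_poly_def eval_monom_def
  by (intro polynomial_fun_sum polynomial_fun_mult polynomial_fun_const polynomial_fun_prod
      polynomial_fun_power polynomial_fun_coord)

text \<open>Each \<open>f\<close> has its own point extending \<open>a\<close>; varying coordinate
  \<open>i\<close> of that point makes \<open>f\<close> a nonzero polynomial in one variable.
  Countably many such polynomials have a common non-root \<open>t\<close>.\<close>

lemma ex_common_nonzero_aux:
  assumes "countable F" and poly: "\<And>f. f \<in> F \<Longrightarrow> polynomial_fun f"
    and A: "\<forall>f\<in>F. \<exists>x. (\<forall>j<i. x j = a j) \<and> f x \<noteq> 0"
  shows "\<exists>t. \<forall>f\<in>F. \<exists>x. (\<forall>j<Suc i. x j = (a(i := t)) j) \<and> f x \<noteq> 0"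
proof -
  obtain X where X: "\<And>f j. f \<in> F \<Longrightarrow> j < i \<Longrightarrow> X f j = a j" "\<And>f. f \<in> F \<Longrightarrow> f (X f) \<noteq> 0"
    using A by metis
  have "\<forall>f\<in>F. \<exists>q. \<forall>t. f ((X f)(i := t)) = poly q t"
    using poly unfolding polynomial_fun_def by blast
  then obtain q where q: "\<And>f t. f \<in> F \<Longrightarrow> f ((X f)(i := t)) = poly (q f) t" by metis
  have "poly (q f) (X f i) \<noteq> 0" if "f \<in> F" for f
    using q[OF that, of "X f i"] X(2)[OF that] by simp
  then have nz: "q f \<noteq> 0" if "f \<in> F" for f using that by force
  obtain t where t: "\<forall>p\<in>q ` F. p \<noteq> 0 \<longrightarrow> poly p t \<noteq> 0"
    using ex_not_root_of_countably_many[OF countable_image[OF assms(1)]] by metis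
  have "(\<forall>j<Suc i. ((X f)(i := t)) j = (a(i := t)) j) \<and> f ((X f)(i := t)) \<noteq> 0" if "f \<in> F" for f
    using X(1)[OF that] q[OF that] t nz[OF that] that by auto
  then show ?thesis by blast
qed

text \<open>Infinitely many coordinates are fixed one by one. Each \<open>f\<close> depends on
  finitely many of them, so a finite stage decides that it does not vanish at the limit
  point.\<close>

lemma ex_common_nonzero:
  assumes F: "countable F" and poly: "\<And>f. f \<in> F \<Longrightarrow> polynomial_fun f"
    and nz: "\<And>f. f \<in> F \<Longrightarrow> \<exists>x. f x \<noteq> 0"
  shows "\<exists>x. \<forall>f\<in>F. f x \<noteq> 0"
proof -
  let ?P = "\<lambda>i a. \<forall>f\<in>F. \<exists>x. (\<forall>j<i. x j = a j) \<and> f x \<noteq> 0"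
  have "\<exists>A. \<forall>i. ?P i (A i) \<and> (\<exists>t. A (Suc i) = (A i)(i := t))"
  proof (rule dependent_nat_choice)
    show "\<exists>a. ?P 0 a" using nz by simp
    fix a i assume "?P i a"
    from ex_common_nonzero_aux[OF F poly this]
    show "\<exists>b. ?P (Suc i) b \<and> (\<exists>t. b = a(i := t))" by blast
  qed
  then obtain A where A: "\<And>i. ?P i (A i)" "\<And>i. \<exists>t. A (Suc i) = (A i)(i := t)" by blast
  \<comment> \<open>Coordinate \<open>j\<close> is chosen in the passage to stage
    \<open>Suc j\<close> and never changes afterwards.\<close>
  have stable: "A n j = A (Suc j) j" if "j < n" for n j
    using that
  proof (induction n)
    case (Suc n)
    obtain t where "A (Suc n) = (A n)(n := t)" using A(2) by blast
    then show ?case using Suc by (cases "j = n") auto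
  qed simp
  have "f (\<lambda>j. A (Suc j) j) \<noteq> 0" if f: "f \<in> F" for f
  proof -
    obtain N where N: "\<And>x y. (\<forall>i<N. x i = y i) \<Longrightarrow> f x = f y"
      using poly[OF f] unfolding polynomial_fun_def by blast
    obtain x where x: "\<forall>j<N. x j = A N j" "f x \<noteq> 0" using A(1) f by blast
    have "x j = A (Suc j) j" if "j < N" for j
      using x(1) stable[OF that] that by metis
    then have "f x = f (\<lambda>j. A (Suc j) j)" by (intro N) blast
    then show ?thesis using x(2) by simp
  qed
  then show ?thesis by blast
qed

text \<open>Dedekind's argument: distinct monomials are distinct characters, hence linearly independent.\<close>

lemma monomials_independent:
  fixes c :: "(nat \<Rightarrow>\<^sub>0 nat) \<Rightarrow> complex"
  assumes "finite K" "K \<noteq> {}" "\<And>m. m \<in> K \<Longrightarrow> c m \<noteq> 0"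
  shows "\<exists>x. (\<Sum>m\<in>K. c m * eval_monom x m) \<noteq> 0"
  using assms
proof (induction "card K" arbitrary: K c rule: less_induct)
  case less
  obtain m0 where m0: "m0 \<in> K" using less.prems by blast
  show ?case
  proof (cases "K = {m0}")
    case True
    have "eval_monom (\<lambda>_. 1 :: complex) m0 = 1" by (simp add: eval_monom_def)
    then show ?thesis using True less.prems(3)[OF m0] by (intro exI[of _ "\<lambda>_. 1"]) simp
  next
    case False
    then obtain m1 where m1: "m1 \<in> K" "m1 \<noteq> m0" using m0 by blast
    then obtain i where i: "Poly_Mapping.lookup m0 i \<noteq> Poly_Mapping.lookup m1 i"
      by (metis poly_mapping_eqI)
    \<comment> \<open>The factor by which the monomial \<open>m\<close> changes when coordinate
      \<open>i\<close> is doubled; powers of 2 with different exponents differ.\<close>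
    define b :: "(nat \<Rightarrow>\<^sub>0 nat) \<Rightarrow> complex" where "b m = 2 ^ Poly_Mapping.lookup m i" for m
    have b: "b m0 \<noteq> b m1"
    proof
      assume "b m0 = b m1"
      then have "norm (b m0) = norm (b m1)" by simp
      then show False using i by (simp add: b_def norm_power)
    qed
    have scale: "eval_monom (\<lambda>j. (if j = i then 2 else 1) * x j) m = b m * eval_monom x m" for x m
    proof -
      have "eval_monom (\<lambda>j. (if j = i then 2 else 1) * x j) m =
          (\<Prod>j\<in>Poly_Mapping.keys m. (if j = i then b m else 1) * x j ^ Poly_Mapping.lookup m j)"
        unfolding eval_monom_def by (intro prod.cong refl) (simp add: power_mult_distrib b_def)
      also have "\<dots> = (\<Prod>j\<in>Poly_Mapping.keys m. if j = i then b m else 1) * eval_monom x m"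
        by (simp add: prod.distrib eval_monom_def)
      also have "(\<Prod>j\<in>Poly_Mapping.keys m. if j = i then b m else 1) = b m"
        by (simp add: b_def in_keys_iff)
      finally show ?thesis .
    qed
    \<comment> \<open>Coefficients of the scaled sum minus \<open>b m1\<close> times the original
      one: the term at \<open>m1\<close> disappears while the one at \<open>m0\<close> stays, so the
      induction hypothesis applies.\<close>
    define c' where "c' m = c m * (b m - b m1)" for m
    let ?K = "{m \<in> K. c' m \<noteq> 0}"
    have "?K \<subset> K" using m1 by (auto simp: c'_def)
    then have "card ?K < card K" using less.prems(1) by (rule psubset_card_mono[rotated])
    moreover have "finite ?K" using less.prems(1) by simp
    moreover have "m0 \<in> ?K" using m0 b less.prems(3) by (simp add: c'_def)
    then have "?K \<noteq> {}" by blast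
    ultimately have "\<exists>x. (\<Sum>m\<in>?K. c' m * eval_monom x m) \<noteq> 0"
      by (rule less.hyps) simp
    then obtain x where "(\<Sum>m\<in>?K. c' m * eval_monom x m) \<noteq> 0" ..
    moreover have "(\<Sum>m\<in>?K. c' m * eval_monom x m) = (\<Sum>m\<in>K. c' m * eval_monom x m)"
      using less.prems(1) by (intro sum.mono_neutral_left) auto
    moreover have "\<dots> = (\<Sum>m\<in>K. c m * eval_monom (\<lambda>j. (if j = i then 2 else 1) * x j) m) -
        b m1 * (\<Sum>m\<in>K. c m * eval_monom x m)"
      unfolding scale c'_def by (simp add: sum_subtractf sum_distrib_left algebra_simps)
    ultimately have "(\<Sum>m\<in>K. c m * eval_monom (\<lambda>j. (if j = i then 2 else 1) * x j) m) \<noteq> 0 \<or>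
        (\<Sum>m\<in>K. c m * eval_monom x m) \<noteq> 0" by auto
    then show ?thesis by blast
  qed
qed

lemma ex_eval_poly_nonzero:
  fixes u :: "int mpoly"
  assumes "u \<noteq> 0"
  shows "\<exists>x :: nat \<Rightarrow> complex. eval_poly of_int x u \<noteq> 0"
  unfolding eval_poly_def using assms
  by (intro monomials_independent) (auto simp: in_keys_iff)

text \<open>Such a map is determined by its graph over the support, a finite set of pairs.\<close>

lemma countable_poly_mapping:
  assumes "countable (UNIV :: 'a set)" and "countable (UNIV :: 'b::zero set)"
  shows "countable (UNIV :: ('a \<Rightarrow>\<^sub>0 'b) set)"
proof -
  let ?g = "\<lambda>u :: 'a \<Rightarrow>\<^sub>0 'b. (\<lambda>k. (k, Poly_Mapping.lookup u k)) ` Poly_Mapping.keys u"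
  have "inj ?g"
  proof (rule injI, rule poly_mapping_eqI)
    fix u v :: "'a \<Rightarrow>\<^sub>0 'b" and k
    assume eq: "?g u = ?g v"
    have "Poly_Mapping.lookup u k = c \<longleftrightarrow> (k, c) \<in> ?g u" if "c \<noteq> 0" for u :: "'a \<Rightarrow>\<^sub>0 'b" and c
      using that by (auto simp: in_keys_iff)
    then show "Poly_Mapping.lookup u k = Poly_Mapping.lookup v k" using eq by metis
  qed
  moreover have "countable {A. finite A \<and> A \<subseteq> (UNIV :: ('a \<times> 'b) set)}"
    using countable_SIGMA[OF assms(1), of "\<lambda>_. UNIV"] assms(2)
    by (intro countable_Collect_finite_subset) simp
  then have "countable (range ?g)"
    by (rule countable_subset[rotated]) auto
  ultimately show ?thesis by (metis countable_image_inj_on)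
qed

section \<open>Flags\<close>

definition basis_matrix :: "(nat \<Rightarrow> 'a ^ 'n) \<Rightarrow> 'a ^ 'n ^ 'n::finite" where
  "basis_matrix b = (\<chi> i k. b (idx k) $ i)"

lemma flag_of_eq_rng:
  fixes b :: "nat \<Rightarrow> 'a::field ^ 'n::finite"
  assumes "j \<le> CARD('n)"
  shows "flag_of b j = rng (basis_matrix b ** diag_upto j)"
proof
  have "column k (basis_matrix b) = b (idx k)" for k
    by (simp add: basis_matrix_def column_def vec_eq_iff)
  then have col: "column k (basis_matrix b ** diag_upto j) = (if idx k < j then b (idx k) else 0)"
    for k by (simp add: column_mult_diag_upto)
  show "rng (basis_matrix b ** diag_upto j) \<subseteq> flag_of b j"
    unfolding flag_of_def by (subst rng_subset_iff_columns)
      (auto simp: col vec.span_zero intro: vec.span_base)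
  have "b i \<in> rng (basis_matrix b ** diag_upto j)" if "i < j" for i
  proof -
    have "i \<in> range (idx :: 'n \<Rightarrow> nat)"
      using bij_idx[where ?'n = 'n] assms that by (auto simp: bij_betw_def)
    then obtain k :: 'n where "i = idx k" by blast
    then show ?thesis using column_in_rng[of k "basis_matrix b ** diag_upto j"] that by (simp add: col)
  qed
  then show "flag_of b j \<subseteq> rng (basis_matrix b ** diag_upto j)"
    unfolding flag_of_def by (intro vec.span_minimal subspace_rng) auto
qed

text \<open>An adapted basis: its vector number \<open>j\<close> is any element of
  \<open>E (Suc j)\<close> outside \<open>E j\<close>.\<close>

lemma complete_flag_eq_flag_of:
  fixes E :: "nat \<Rightarrow> ('a::field ^ 'n::finite) set"
  assumes "complete_flag E"
  shows "\<exists>b. \<forall>j\<le>CARD('n). flag_of b j = E j"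
proof -
  have E: "vec.subspace (E j)" "vec.dim (E j) = j" if "j \<le> CARD('n)" for j
    using assms that by (auto simp: complete_flag_def)
  have "\<forall>j. \<exists>v. j < CARD('n) \<longrightarrow> v \<in> E (Suc j) - E j"
    using assms by (auto simp: complete_flag_def)
  then obtain b where b: "\<And>j. j < CARD('n) \<Longrightarrow> b j \<in> E (Suc j) - E j" by metis
  have "flag_of b j = E j" if "j \<le> CARD('n)" for j
    using that
  proof (induction j)
    case 0
    have "E 0 \<subseteq> {0}" using E(2)[of 0] vec.dim_eq_0 by blast
    then have "E 0 = {0}" using vec.subspace_0[OF E(1)[of 0]] by auto
    then show ?case by (simp add: flag_of_def)
  next
    case (Suc j)
    have IH: "vec.span (b ` {..<j}) = E j" using Suc by (simp add: flag_of_def)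
    have im: "b ` {..<Suc j} = insert (b j) (b ` {..<j})" by (auto simp: less_Suc_eq)
    have "E j \<subset> E (Suc j)"
      using assms Suc_le_lessD[OF Suc.prems] unfolding complete_flag_def by blast
    then have "b ` {..<Suc j} \<subseteq> E (Suc j)"
      unfolding im using IH b[of j] Suc.prems vec.span_superset[of "b ` {..<j}"] by auto
    then have "flag_of b (Suc j) \<subseteq> E (Suc j)"
      unfolding flag_of_def using E(1)[OF Suc.prems] by (rule vec.span_minimal)
    moreover have "vec.dim (b ` {..<j}) = j"
      using IH E(2)[of j] Suc.prems by (metis Suc_leD vec.dim_span)
    then have "vec.dim (flag_of b (Suc j)) = Suc j"
      unfolding flag_of_def vec.dim_span im vec.dim_insert IH using b[of j] Suc.prems by simp
    ultimately show ?case
      using E[OF Suc.prems] by (intro vec.subspace_dim_equal) (auto simp: flag_of_def)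
  qed
  then show ?thesis by blast
qed

definition schubert_conditions ::
  "(nat \<Rightarrow> 'a::field ^ 'n::finite) \<Rightarrow> nat set \<Rightarrow> (('a ^ 'n ^ 'n) \<times> nat) set" where
  "schubert_conditions b I =
     (\<lambda>l. (basis_matrix b ** diag_upto (nth_elem I l), l)) ` {1..card I}"

lemma nth_elem_mem:
  assumes "finite I" and "l \<in> {1..card I}"
  shows "nth_elem I l \<in> I"
proof -
  have "sorted_list_of_set I ! (l - 1) \<in> set (sorted_list_of_set I)"
    using assms by (intro nth_mem) auto
  then show ?thesis using assms(1) by (simp add: nth_elem_def)
qed

lemma schubert_variety_eq_solutions:
  fixes b :: "nat \<Rightarrow> 'a::field ^ 'n::finite"
  assumes "I \<subseteq> {1..CARD('n)}"
  shows "schubert_variety (flag_of b) I = solutions (schubert_conditions b I) (card I)"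
proof -
  have "flag_of b (nth_elem I l) = rng (basis_matrix b ** diag_upto (nth_elem I l))"
    if "l \<in> {1..card I}" for l
    using nth_elem_mem[OF finite_subset[OF assms] that] assms by (intro flag_of_eq_rng) auto
  then show ?thesis
    by (auto simp: schubert_variety_def solutions_def schubert_conditions_def)
qed

lemma solutions_Un: "solutions (C \<union> D) r = solutions C r \<inter> solutions D r"
  by (auto simp: solutions_def)

lemma (in ring_hom_on) map_schubert_conditions:
  fixes b :: "nat \<Rightarrow> 'a ^ 'n::finite"
  assumes "\<And>j k. b j $ k \<in> T"
  shows "(\<lambda>(P, l). (map_matrix \<sigma> P, l)) ` schubert_conditions b I =
         schubert_conditions (\<lambda>j. \<chi> k. \<sigma> (b j $ k)) I"
proof -
  have "map_matrix \<sigma> (basis_matrix b ** diag_upto m) =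
      basis_matrix (\<lambda>j. \<chi> k. \<sigma> (b j $ k)) ** diag_upto m" for m
  proof -
    have "map_matrix \<sigma> (basis_matrix b) = basis_matrix (\<lambda>j. \<chi> k. \<sigma> (b j $ k))"
      by (simp add: vec_eq_iff basis_matrix_def)
    moreover have "basis_matrix b $ i $ j \<in> T" for i j
      using assms by (simp add: basis_matrix_def)
    ultimately show ?thesis
      by (subst map_matrix_mult) (simp_all add: diag_upto_mem map_matrix_diag_upto)
  qed
  then show ?thesis by (simp add: schubert_conditions_def image_image)
qed

text \<open>The values \<open>s = 0, 1, 2\<close> give three tuples of vectors whose coordinates are distinct variables.\<close>

definition tuple :: "(nat \<Rightarrow> 'a) \<Rightarrow> nat \<Rightarrow> nat \<Rightarrow> 'a ^ 'n::finite" where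
  "tuple x s = (\<lambda>j. \<chi> k. x (to_nat (s, j, k)))"

lemma polynomial_fun_polynomial3:
  fixes p :: "(nat \<Rightarrow> complex ^ 'n::finite) \<Rightarrow> (nat \<Rightarrow> complex ^ 'n) \<Rightarrow> (nat \<Rightarrow> complex ^ 'n) \<Rightarrow> complex"
  assumes "polynomial3 p"
  shows "polynomial_fun (\<lambda>x. p (tuple x 0) (tuple x 1) (tuple x 2))"
  using assms
proof induction
  case (const z)
  then show ?case by (rule polynomial_fun_const)
next
  case (add p q)
  then show ?case by (intro polynomial_fun_add)
next
  case (mult p q)
  then show ?case by (intro polynomial_fun_mult)
qed (simp_all add: tuple_def polynomial_fun_coord)

text \<open>Nonvanishing of \<open>p\<close>, of the three determinants that express
  \<open>is_basis\<close>, and of all nonzero integer polynomials are countably many conditions, so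
  one point meets them together. Integer coefficients are what keeps the number of conditions
  countable.\<close>

lemma ex_generic_point:
  fixes P :: "(nat \<Rightarrow> (complex ^ 'n::finite) set) \<Rightarrow> (nat \<Rightarrow> (complex ^ 'n) set) \<Rightarrow>
    (nat \<Rightarrow> (complex ^ 'n) set) \<Rightarrow> bool"
  assumes "for_generic_flags P"
  shows "\<exists>x. P (flag_of (tuple x 0)) (flag_of (tuple x 1)) (flag_of (tuple x 2)) \<and>
    (\<forall>u :: int mpoly. u \<noteq> 0 \<longrightarrow> eval_poly of_int x u \<noteq> 0)"
proof -
  obtain p a b c where p: "polynomial3 p" "is_basis a" "is_basis b" "is_basis c" "p a b c \<noteq> 0"
    "\<And>a b c. is_basis a \<Longrightarrow> is_basis b \<Longrightarrow> is_basis c \<Longrightarrow> p a b c \<noteq> 0 \<Longrightarrow>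
       P (flag_of a) (flag_of b) (flag_of c)"
    using assms unfolding for_generic_flags_def by blast
  define d :: "nat \<Rightarrow> (nat \<Rightarrow> complex) \<Rightarrow> complex" where
    "d s x = det (\<chi> i k. (tuple x s :: nat \<Rightarrow> complex ^ 'n) (idx i) $ k)" for s x
  have d: "d s x \<noteq> 0 \<longleftrightarrow> is_basis (tuple x s :: nat \<Rightarrow> complex ^ 'n)" for s x
    unfolding d_def using is_basis_iff_det[OF bij_idx] by blast
  let ?p = "\<lambda>x. p (tuple x 0) (tuple x 1) (tuple x 2)"
  let ?F = "{?p, d 0, d 1, d 2} \<union> (\<lambda>u x. eval_poly of_int x u) ` {u :: int mpoly. u \<noteq> 0}"
  have "\<exists>x. \<forall>f\<in>?F. f x \<noteq> 0"
  proof (rule ex_common_nonzero)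
    have "countable (UNIV :: int mpoly set)"
      by (intro countable_poly_mapping) auto
    then have "countable {u :: int mpoly. u \<noteq> 0}" by (rule countable_subset[rotated]) simp
    then show "countable ?F" by simp
  next
    fix f assume "f \<in> ?F"
    moreover have "polynomial_fun (d s)" for s
      unfolding d_def det_def tuple_def vec_lambda_beta
      by (intro polynomial_fun_sum polynomial_fun_mult polynomial_fun_const polynomial_fun_prod
          polynomial_fun_coord)
    ultimately show "polynomial_fun f"
      using polynomial_fun_polynomial3[OF p(1)] polynomial_fun_eval_poly by auto
  next
    \<comment> \<open>Decoding the positions produces a point whose three tuples are the bases
      \<open>a\<close>, \<open>b\<close>, \<open>c\<close>, where neither \<open>p\<close> nor a
      determinant vanishes.\<close>
    define y where "y n = (case from_nat n of (s :: nat, j, k) \<Rightarrow>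
      (if s = 0 then a else if s = 1 then b else c) j $ (k :: 'n))" for n
    have y: "tuple y 0 = a" "tuple y 1 = b" "tuple y 2 = c"
      by (simp_all add: tuple_def y_def vec_eq_iff fun_eq_iff)
    fix f assume "f \<in> ?F"
    moreover have "?p y \<noteq> 0" "d 0 y \<noteq> 0" "d 1 y \<noteq> 0" "d 2 y \<noteq> 0"
      using p y d by auto
    ultimately show "\<exists>x. f x \<noteq> 0" using ex_eval_poly_nonzero by auto
  qed
  then obtain x where "\<forall>f\<in>?F. f x \<noteq> 0" ..
  then have "?p x \<noteq> 0" "d 0 x \<noteq> 0" "d 1 x \<noteq> 0" "d 2 x \<noteq> 0"
    "\<forall>u :: int mpoly. u \<noteq> 0 \<longrightarrow> eval_poly of_int x u \<noteq> 0" by auto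
  then show ?thesis using p(6) d by blast
qed

text \<open>The default value in \<open>lr_coeff\<close> is 0, so a nonzero value comes from an
  actual generic count.\<close>

lemma generic_count_if_lr_coeff_nonzero:
  assumes "lr_coeff T I J K \<noteq> 0"
  shows "generic_count T I J K (lr_coeff T I J K)"
proof -
  obtain m where "generic_count T I J K m"
    using assms by (auto simp: lr_coeff_def split: if_splits)
  then show ?thesis using lr_coeff_eqI by metis
qed

lemma countable_fract: "countable (UNIV :: 'a::idom set) \<Longrightarrow> countable (UNIV :: 'a fract set)"
proof -
  assume c: "countable (UNIV :: 'a set)"
  have "x \<in> (\<lambda>(u, w). Fract u w) ` (UNIV :: ('a \<times> 'a) set)" for x
    by (cases x) auto
  then have "UNIV = (\<lambda>(u, w). Fract u w) ` (UNIV \<times> UNIV :: ('a \<times> 'a) set)" by auto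
  then show ?thesis using c by (metis countable_SIGMA countable_image)
qed

theorem theorem0p6:
  fixes E F G :: "nat \<Rightarrow> ('a::field ^ 'n::finite) set"
    and I J K :: "nat set" and r :: nat
  assumes "complete_flag E" and "complete_flag F" and "complete_flag G"
    and "1 \<le> r" and "r \<le> CARD('n)"
    and "I \<subseteq> {1..CARD('n)}" and "card I = r"
    and "J \<subseteq> {1..CARD('n)}" and "card J = r"
    and "K \<subseteq> {1..CARD('n)}" and "card K = r"
    and "lr_condition CARD('n) r I J K"
    and "lr_coeff TYPE('n) I J K = 1"
  shows "\<exists>M :: ('a ^ 'n) set. vec.subspace M \<and> vec.dim M = r \<and>
           (\<forall>l\<in>{1..r}. vec.dim (M \<inter> E (nth_elem I l)) \<ge> l \<and>
                       vec.dim (M \<inter> F (nth_elem J l)) \<ge> l \<and>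
                       vec.dim (M \<inter> G (nth_elem K l)) \<ge> l)"
proof -
  note subsets = assms(6,8,10) and cards = assms(7,9,11)
  let ?C = "\<lambda>a b c. schubert_conditions a I \<union> schubert_conditions b J \<union> schubert_conditions c K"
  \<comment> \<open>The tuples of these variables have two specializations: \<open>\<iota>\<close>
    sends them to the generic complex point \<open>x\<close>, and \<open>\<pi>\<close> sends them to
    bases adapted to the given flags.\<close>
  define X :: "nat \<Rightarrow> int mpoly fract" where "X i = Fract (Var i) 1" for i
  let ?X = "\<lambda>s. tuple X s :: nat \<Rightarrow> int mpoly fract ^ 'n"

  have "generic_count TYPE('n) I J K 1"
    using generic_count_if_lr_coeff_nonzero[of "TYPE('n)" I J K] assms(13) by simp
  from ex_generic_point[OF this[unfolded generic_count_def]] obtain x where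
    x: "card (schubert_variety (flag_of (tuple x 0 :: nat \<Rightarrow> complex ^ 'n)) I \<inter>
      schubert_variety (flag_of (tuple x 1)) J \<inter> schubert_variety (flag_of (tuple x 2)) K) = 1"
    and inj: "\<And>u :: int mpoly. u \<noteq> 0 \<Longrightarrow> eval_poly of_int x u \<noteq> 0" by blast
  interpret of_int: comm_ring_hom "of_int :: int \<Rightarrow> complex" by (rule comm_ring_hom_of_int)
  obtain \<iota> :: "int mpoly fract \<Rightarrow> complex"
    where \<iota>: "ring_hom_on UNIV \<iota>" "\<forall>u. \<iota> (Fract u 1) = eval_poly of_int x u"
    using ex_fract_embedding[OF of_int.comm_ring_hom_eval_poly inj] by blast
  have \<iota>X: "\<iota> (X i) = x i" for i using \<iota>(2) by (simp add: X_def of_int.eval_poly_Var)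
  have map_\<iota>: "(\<lambda>(P, l). (map_matrix \<iota> P, l)) ` ?C (?X 0) (?X 1) (?X 2) =
      ?C (tuple x 0) (tuple x 1) (tuple x 2)"
    by (simp add: image_Un ring_hom_on.map_schubert_conditions[OF \<iota>(1)] tuple_def \<iota>X)
  have "solutions (?C (?X 0) (?X 1) (?X 2)) r \<noteq> {}"
  proof (rule solutions_descend_countable[OF \<iota>(1)])
    show "countable (UNIV :: int mpoly fract set)"
      by (intro countable_fract countable_poly_mapping) auto
    show "finite (?C (?X 0) (?X 1) (?X 2))" by (simp add: schubert_conditions_def)
    show "card (solutions ((\<lambda>(P, l). (map_matrix \<iota> P, l)) ` ?C (?X 0) (?X 1) (?X 2)) r) = 1"
      using x unfolding map_\<iota> solutions_Un cards subsets[THEN schubert_variety_eq_solutions] .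
  qed
  then obtain M where M: "M \<in> solutions (?C (?X 0) (?X 1) (?X 2)) r" by blast

  obtain e where e: "\<And>j. j \<le> CARD('n) \<Longrightarrow> flag_of e j = E j"
    using complete_flag_eq_flag_of[OF assms(1)] by blast
  obtain f where f: "\<And>j. j \<le> CARD('n) \<Longrightarrow> flag_of f j = F j"
    using complete_flag_eq_flag_of[OF assms(2)] by blast
  obtain g where g: "\<And>j. j \<le> CARD('n) \<Longrightarrow> flag_of g j = G j"
    using complete_flag_eq_flag_of[OF assms(3)] by blast
  define y where "y n = (case from_nat n of (s :: nat, j, k) \<Rightarrow>
    (if s = 0 then e else if s = 1 then f else g) j $ (k :: 'n))" for n
  have y: "tuple y 0 = e" "tuple y 1 = f" "tuple y 2 = g"
    by (simp_all add: tuple_def y_def vec_eq_iff fun_eq_iff)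
  obtain O\<^sub>v and \<pi> :: "int mpoly fract \<Rightarrow> 'a" where "place O\<^sub>v \<pi>"
    and \<pi>: "\<And>i. X i \<in> O\<^sub>v" "\<And>i. \<pi> (X i) = y i"
    using ex_place_generic[of y] unfolding X_def by blast
  interpret place O\<^sub>v \<pi> by fact
  have map_\<pi>: "(\<lambda>(P, l). (map_matrix \<pi> P, l)) ` schubert_conditions (?X s) L =
      schubert_conditions (tuple y s) L" for s L
    using map_schubert_conditions[of "?X s"] \<pi> by (simp add: tuple_def)
  \<comment> \<open>Ranks do not drop under \<open>\<pi>\<close>: the generic matrix has at most
    \<open>m\<close> nonzero columns, while its reduction spans a flag member of dimension exactly
    \<open>m\<close>.\<close>
  have mem: "P $ i $ j \<in> O\<^sub>v"
    and dim: "vec.dim (rng P) \<le> vec.dim (rng (map_matrix \<pi> P))"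
    if PC: "(P, l) \<in> schubert_conditions (?X s) L" and L: "L \<subseteq> {1..CARD('n)}"
      and dim_flag: "\<And>m. m \<le> CARD('n) \<Longrightarrow> vec.dim (flag_of (tuple y s :: nat \<Rightarrow> 'a ^ 'n) m) = m"
    for P l s L i j
  proof -
    obtain m where m: "m \<in> L" "P = basis_matrix (?X s) ** diag_upto m"
      using PC nth_elem_mem[OF finite_subset[OF L finite_atLeastAtMost]]
      unfolding schubert_conditions_def by blast
    have B: "basis_matrix (?X s) $ i $ j \<in> O\<^sub>v" for i j
      using \<pi>(1) by (simp add: basis_matrix_def tuple_def)
    show "P $ i $ j \<in> O\<^sub>v" unfolding m(2) by (rule matrix_mult_mem[OF B diag_upto_mem])
    have "map_matrix \<pi> P = basis_matrix (tuple y s) ** diag_upto m"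
      unfolding m(2) map_matrix_mult[OF B diag_upto_mem] map_matrix_diag_upto
      by (simp add: basis_matrix_def tuple_def vec_eq_iff map_matrix_def \<pi>(2))
    then have "vec.dim (rng (map_matrix \<pi> P)) = m"
      using dim_flag[of m] m(1) L flag_of_eq_rng[of m "tuple y s :: nat \<Rightarrow> 'a ^ 'n"] by fastforce
    moreover have "vec.dim (rng P) \<le> m"
      using dim_rng_mult_diag_upto_le[of "basis_matrix (?X s)" m "mat 1"] by (simp add: m(2))
    ultimately show "vec.dim (rng P) \<le> vec.dim (rng (map_matrix \<pi> P))" by simp
  qed
  have dims: "vec.dim (E m) = m" "vec.dim (F m) = m" "vec.dim (G m) = m" if "m \<le> CARD('n)" for m
    using assms(1-3) that by (auto simp: complete_flag_def)
  have "reduction M \<in> solutions ((\<lambda>(P, l). (map_matrix \<pi> P, l)) ` ?C (?X 0) (?X 1) (?X 2)) r"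
    using mem[of _ _ 0 I] mem[of _ _ 1 J] mem[of _ _ 2 K] dim[of _ _ 0 I] dim[of _ _ 1 J]
      dim[of _ _ 2 K] subsets dims
    by (intro solutions_reduction[OF M]) (auto simp only: Un_iff y e f g)
  also have "\<dots> = schubert_variety (flag_of e) I \<inter> schubert_variety (flag_of f) J \<inter>
      schubert_variety (flag_of g) K"
    unfolding image_Un map_\<pi> y solutions_Un cards subsets[THEN schubert_variety_eq_solutions] ..
  finally have "reduction M \<in> schubert_variety (flag_of e) I \<inter> schubert_variety (flag_of f) J \<inter>
      schubert_variety (flag_of g) K" .
  moreover have "nth_elem L l \<le> CARD('n)" if "L \<subseteq> {1..CARD('n)}" "l \<in> {1..card L}" for L l
    using nth_elem_mem[OF finite_subset[OF that(1)] that(2)] that(1) by auto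
  ultimately show ?thesis
    using subsets cards by (intro exI[of _ "reduction M"]) (auto simp: schubert_variety_def e f g)
qed

end
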